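(* Let $n\ge1$. Then: (1) $T_{\varpi_1}(\tilde\psi_n)=\tilde\psi_n$; (2) $[E_{k\delta-\alpha_1},E_{l\delta+\alpha_1}]_{q^{-1}}=\tilde\psi_n$ for all $k\ge1$, $l\ge0$ with $k+l=n$; (3) $(T_1^{-1}\ast)(\tilde\psi_n)=\tilde\psi_n$; (4) $[\tilde\psi_n,E_{k\delta+\alpha_1}]=(1+q^{-1})\sum_{i=0}^{n-1}b_{2(n-i)}E_{(k+n-i)\delta+\alpha_1}\tilde\psi_i$ for $k\ge0$; (5) $[E_{k\delta-\alpha_1},\tilde\psi_n]=(1+q^{-1})\sum_{i=0}^{n-1}b_{2(n-i)}\tilde\psi_iE_{(k+n-i)\delta-\alpha_1}$ for $k\ge1$; (6) $[\tilde\psi_n,\tilde\psi_1]=0$; (7) $[E_{\alpha_0},E_{n\delta+\alpha_1}]_{q^{-2}}=(q_1-q_1^{-1})\sum_{i=0}^{n}b_{2(n-i)+1}\tilde\psi_iE_{(n-i+1)\delta-\alpha_1}$.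
   Context: Algebra. Let $q_1$ be an indeterminate, $q=q_1^2$, $q_0=q^2$ (powers $q^a$ with $a\in\frac12\mathbb Z$ lie in $\mathbb Q(q_1)$). Let $I=\{0,1\}$; for $i\in I$, $[k]_i=(q_i^k-q_i^{-k})/(q_i-q_i^{-1})$, $[n]_i!=\prod_{p=1}^n[p]_i$, $[0]_i!=1$. Let $X,Y$ be finitely generated free $\mathbb Z$-modules with perfect pairing $\langle\,,\rangle:Y\times X\to\mathbb Z$, with linearly independent simple roots $\alpha_0,\alpha_1\in X$ and linearly independent simple coroots $h_0,h_1\in Y$, and $a_{ij}=\langle h_i,\alpha_j\rangle$: $a_{00}=a_{11}=2$, $a_{01}=-1$, $a_{10}=-4$ (type $A_2^{(2)}$); $\delta=\alpha_0+2\alpha_1$. $\mathbf U$ is the $\mathbb Q(q_1)$-algebra generated by $q^h$ ($h\in\frac12Y$), $e_i,f_i$ ($i\in I$) with relations $q^0=1$, $q^hq^{h'}=q^{h+h'}$, $q^he_iq^{-h}=q^{\langle h,\alpha_i\rangle}e_i$, $q^hf_iq^{-h}=q^{-\langle h,\alpha_i\rangle}f_i$, $[e_i,f_j]=\delta_{ij}\frac{k_i-k_i^{-1}}{q_i-q_i^{-1}}$, and for $i\ne j$ $\sum_{k=0}^{1-a_{ij}}(-1)^ke_i^{(k)}e_je_i^{(1-a_{ij}-k)}=0$ and the same with $f$ in place of $e$, where $k_0=q^{2h_0}$, $k_1=q^{h_1/2}$, $e_i^{(k)}=e_i^k/[k]_i!$, $f_i^{(k)}=f_i^k/[k]_i!$.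 Brackets: $[x,y]_v=xy-vyx$, $[x,y]=[x,y]_1$. Operators. $T_i$ ($i\in I$) is the automorphism of $\mathbf U$ with $T_i(q^h)=q^{h-\langle h,\alpha_i\rangle h_i}$, $T_i(e_i)=-f_ik_i$, $T_i(f_i)=-k_i^{-1}e_i$, and for $j\neq i$: $T_i(e_j)=\sum_{r=0}^{-a_{ij}}(-1)^rq_i^{-r}e_i^{(-a_{ij}-r)}e_je_i^{(r)}$, $T_i(f_j)=\sum_{r=0}^{-a_{ij}}(-1)^rq_i^{r}f_i^{(r)}f_jf_i^{(-a_{ij}-r)}$. $T_{\varpi_1}=T_0T_1$. $\ast$ is the $\mathbb Q(q_1)$-linear anti-involution of $\mathbf U$ with $\ast(q^h)=q^{-h}$, $\ast(e_i)=e_i$, $\ast(f_i)=f_i$; $T_1^{-1}\ast$ denotes the composition ($\ast$ first). Root vectors. For $n\ge0$: $E_{n\delta+\alpha_1}=(T_1^{-1}T_0^{-1})^n(e_1)$, $E_{2n\delta+\alpha_0}=(T_0T_1)^n(e_0)$, $E_{(n+1)\delta-\alpha_1}=(T_0T_1)^nT_0(e_1)$. For $n\ge1$: $\tilde\psi_n=[E_{\delta-\alpha_1},E_{(n-1)\delta+\alpha_1}]_{q^{-1}}$; $\tilde\psi_0=(q_1-q_1^{-1})^{-1}$. Coefficients. For $i\in\mathbb Z$, $b_{2i}=\frac{(1-q)((-q)^{-i}-q^{2i}(q+q^{-1}))}{1-q+q^2}$ and $b_{2i+1}=\frac{(-q)^{-i}+q^{2i+1}(q-1)}{1-q+q^2}$;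 these lie in $\mathbb Z[q,q^{-1}]$. *)

theory Defs
  imports "HOL-Library.Poly_Mapping" "HOL-Computational_Algebra.Computational_Algebra"
begin

section \<open>The ground field and quantum integers\<close>

type_synonym Qq1 = "rat poly fract"

definition q1 :: Qq1 where
  "q1 = Fract [:0, 1:] 1"

definition q :: Qq1 where
  "q = q1 ^ 2"

datatype node = N0 | N1

text \<open>Here \<open>qn i\<close> is $q_i$; in particular \<open>qn N1\<close> is the indeterminate itself.\<close>

fun qn :: "node \<Rightarrow> Qq1" where
  "qn N0 = q ^ 2"
| "qn N1 = q1"

fun cartan :: "node \<Rightarrow> node \<Rightarrow> int" where
  "cartan N0 N0 = 2"
| "cartan N0 N1 = -1"
| "cartan N1 N0 = -4"
| "cartan N1 N1 = 2"

definition qint :: "node \<Rightarrow> nat \<Rightarrow> Qq1" where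
  "qint i k = (qn i ^ k - inverse (qn i) ^ k) / (qn i - inverse (qn i))"

definition qfact :: "node \<Rightarrow> nat \<Rightarrow> Qq1" where
  "qfact i n = (\<Prod>p=1..n. qint i p)"

text \<open>The coefficients $b_m$ for $m \in \mathbb Z$; for both parities $i = \lfloor m/2 \rfloor$.\<close>

definition bcoef :: "int \<Rightarrow> Qq1" where
  "bcoef m = (let i = m div 2 in
     if even m
     then (1 - q) * ((- q) powi (- i) - q powi (2 * i) * (q + inverse q)) / (1 - q + q ^ 2)
     else ((- q) powi (- i) + q powi (2 * i + 1) * (q - 1)) / (1 - q + q ^ 2))"


section \<open>Root datum\<close>

definition fg_free :: "(int \<Rightarrow> 'a \<Rightarrow> 'a::ab_group_add) \<Rightarrow> bool" where
  "fg_free s \<longleftrightarrow> module s \<and>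
     (\<exists>B. finite B \<and> \<not> module.dependent s B \<and> module.span s B = UNIV)"

definition perfect_pairing ::
  "(int \<Rightarrow> 'x \<Rightarrow> 'x::ab_group_add) \<Rightarrow> (int \<Rightarrow> 'y \<Rightarrow> 'y::ab_group_add) \<Rightarrow> ('y \<Rightarrow> 'x \<Rightarrow> int) \<Rightarrow> bool"
where
  "perfect_pairing sX sY pair \<longleftrightarrow>
     (\<forall>y. module_hom sX (*) (pair y)) \<and>
     (\<forall>x. module_hom sY (*) (\<lambda>y. pair y x)) \<and>
     (\<forall>\<phi>. module_hom sX (*) \<phi> \<longrightarrow> (\<exists>!y. pair y = \<phi>)) \<and>
     (\<forall>\<phi>. module_hom sY (*) \<phi> \<longrightarrow> (\<exists>!x. (\<lambda>y. pair y x) = \<phi>))"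

text \<open>
  \<open>sX\<close> and \<open>sY\<close> are the (unique) actions of the integers on the abelian groups \<open>'x\<close> and \<open>'y\<close>;
  \<open>\<alpha> i\<close> are the simple roots and \<open>h i\<close> the simple coroots.
\<close>

locale A22_datum =
  fixes sX :: "int \<Rightarrow> 'x \<Rightarrow> 'x::ab_group_add"
    and sY :: "int \<Rightarrow> 'y \<Rightarrow> 'y::ab_group_add"
    and pair :: "'y \<Rightarrow> 'x \<Rightarrow> int"
    and \<alpha> :: "node \<Rightarrow> 'x"
    and h :: "node \<Rightarrow> 'y"
  assumes free_X: "fg_free sX"
    and free_Y: "fg_free sY"
    and perfect: "perfect_pairing sX sY pair"
    and roots_independent: "inj \<alpha>" "\<not> module.dependent sX (range \<alpha>)"
    and coroots_independent: "inj h" "\<not> module.dependent sY (range h)"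
    and pair_cartan: "pair (h i) (\<alpha> j) = cartan i j"


section \<open>Algebras over the ground field, free algebras and presentations\<close>

locale alg =
  vector_space scale for scale :: "Qq1 \<Rightarrow> 'u \<Rightarrow> 'u::ring_1" +
  assumes scale_mult_left: "scale c x * y = scale c (x * y)"
    and mult_scale_right: "x * scale c y = scale c (x * y)"

text \<open>
  The free monoid on \<open>'g\<close>, written additively so that finitely supported functions on it form the
  free unital associative algebra under convolution.
\<close>

datatype 'g word = Word (letters: "'g list")

instantiation word :: (type) monoid_add
begin

definition zero_word :: "'a word" where
  "zero_word = Word []"

definition plus_word :: "'a word \<Rightarrow> 'a word \<Rightarrow> 'a word" where
  "plus_word v w = Word (letters v @ letters w)"

instance
  by standard (simp_all add: zero_word_def plus_word_def)

end

type_synonym 'g free_alg = "'g word \<Rightarrow>\<^sub>0 Qq1"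

definition fgen :: "'g \<Rightarrow> 'g free_alg" where
  "fgen g = Poly_Mapping.single (Word [g]) 1"

definition fscale :: "Qq1 \<Rightarrow> 'g free_alg \<Rightarrow> 'g free_alg" where
  "fscale c p = Poly_Mapping.single 0 c * p"

definition feval :: "(Qq1 \<Rightarrow> 'u \<Rightarrow> 'u::ring_1) \<Rightarrow> ('g \<Rightarrow> 'u) \<Rightarrow> 'g free_alg \<Rightarrow> 'u" where
  "feval scale v p =
     (\<Sum>w\<in>Poly_Mapping.keys p. scale (Poly_Mapping.lookup p w) (prod_list (map v (letters w))))"

inductive_set two_sided_ideal :: "'r::ring_1 set \<Rightarrow> 'r set" for R :: "'r set" where
  zero: "0 \<in> two_sided_ideal R"
| gen: "r \<in> R \<Longrightarrow> a * r * b \<in> two_sided_ideal R"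
| add: "x \<in> two_sided_ideal R \<Longrightarrow> y \<in> two_sided_ideal R \<Longrightarrow> x + y \<in> two_sided_ideal R"

text \<open>
  The algebra \<open>'u\<close> is generated by the elements \<open>v g\<close> with defining relators \<open>R\<close>, i.e. the
  canonical map from the free algebra induces an isomorphism from its quotient by the ideal
  generated by \<open>R\<close>.
\<close>

definition presented_by ::
  "(Qq1 \<Rightarrow> 'u \<Rightarrow> 'u::ring_1) \<Rightarrow> ('g \<Rightarrow> 'u) \<Rightarrow> 'g free_alg set \<Rightarrow> bool"
where
  "presented_by scale v R \<longleftrightarrow> alg scale \<and> surj (feval scale v) \<and>
     {p. feval scale v p = 0} = two_sided_ideal R"

definition alg_automorphism :: "(Qq1 \<Rightarrow> 'u \<Rightarrow> 'u::ring_1) \<Rightarrow> ('u \<Rightarrow> 'u) \<Rightarrow> bool" where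
  "alg_automorphism scale \<phi> \<longleftrightarrow> Vector_Spaces.linear scale scale \<phi> \<and> \<phi> 1 = 1 \<and>
     (\<forall>x y. \<phi> (x * y) = \<phi> x * \<phi> y) \<and> bij \<phi>"

definition alg_anti_involution :: "(Qq1 \<Rightarrow> 'u \<Rightarrow> 'u::ring_1) \<Rightarrow> ('u \<Rightarrow> 'u) \<Rightarrow> bool" where
  "alg_anti_involution scale \<phi> \<longleftrightarrow> Vector_Spaces.linear scale scale \<phi> \<and> \<phi> 1 = 1 \<and>
     (\<forall>x y. \<phi> (x * y) = \<phi> y * \<phi> x) \<and> (\<forall>x. \<phi> (\<phi> x) = x)"

definition bracket :: "(Qq1 \<Rightarrow> 'u \<Rightarrow> 'u::ring_1) \<Rightarrow> Qq1 \<Rightarrow> 'u \<Rightarrow> 'u \<Rightarrow> 'u" where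
  "bracket scale v x y = x * y - scale v (y * x)"

definition divpow :: "(Qq1 \<Rightarrow> 'u \<Rightarrow> 'u::ring_1) \<Rightarrow> node \<Rightarrow> 'u \<Rightarrow> nat \<Rightarrow> 'u" where
  "divpow scale i x k = scale (inverse (qfact i k)) (x ^ k)"


section \<open>The quantum affine algebra\<close>

text \<open>
  Elements of $\frac12 Y$ are represented by their doubles: \<open>K y\<close> (and \<open>GenK y\<close>) stands for
  $q^{y/2}$ with $y \in Y$. Hence $q^{\langle y/2, x\rangle} = q_1^{\langle y, x\rangle}$,
  $k_0 = q^{2h_0}$ is \<open>K\<close> at $4h_0$, and $k_1 = q^{h_1/2}$ is \<open>K\<close> at $h_1$.
\<close>

datatype 'y gen = GenK 'y | GenE node | GenF node

fun kdouble :: "(int \<Rightarrow> 'y \<Rightarrow> 'y) \<Rightarrow> (node \<Rightarrow> 'y) \<Rightarrow> node \<Rightarrow> 'y" where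
  "kdouble sY h N0 = sY 4 (h N0)"
| "kdouble sY h N1 = h N1"

definition serre :: "(Qq1 \<Rightarrow> 'u \<Rightarrow> 'u::ring_1) \<Rightarrow> (node \<Rightarrow> 'u) \<Rightarrow> node \<Rightarrow> node \<Rightarrow> 'u" where
  "serre scale x i j =
     (\<Sum>k=0..nat (1 - cartan i j).
        (-1) ^ k * divpow scale i (x i) k * x j * divpow scale i (x i) (nat (1 - cartan i j) - k))"

definition relators ::
  "(int \<Rightarrow> 'y \<Rightarrow> 'y::ab_group_add) \<Rightarrow> ('y \<Rightarrow> 'x \<Rightarrow> int) \<Rightarrow> (node \<Rightarrow> 'x) \<Rightarrow> (node \<Rightarrow> 'y)
     \<Rightarrow> 'y gen free_alg set"
where
  "relators sY pair \<alpha> h =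
    (let K = \<lambda>y. fgen (GenK y); E = \<lambda>i. fgen (GenE i); F = \<lambda>i. fgen (GenF i) in
       {K 0 - 1}
     \<union> {K y * K y' - K (y + y') | y y'. True}
     \<union> {K y * E i * K (- y) - fscale (q1 powi pair y (\<alpha> i)) (E i) | y i. True}
     \<union> {K y * F i * K (- y) - fscale (q1 powi (- pair y (\<alpha> i))) (F i) | y i. True}
     \<union> {E i * F j - F j * E i
          - (if i = j
             then fscale (inverse (qn i - inverse (qn i)))
                    (K (kdouble sY h i) - K (- kdouble sY h i))
             else 0) | i j. True}
     \<union> {serre fscale E i j | i j. i \<noteq> j}
     \<union> {serre fscale F i j | i j. i \<noteq> j})"

text \<open>
  Beside the algebra, the locale fixes the automorphisms \<open>T i\<close> and the anti-involution \<open>star\<close>,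
  which are determined by the stated values on generators.
\<close>

locale quantum_A22 = A22_datum sX sY pair \<alpha> h
  for sX :: "int \<Rightarrow> 'x \<Rightarrow> 'x::ab_group_add"
    and sY :: "int \<Rightarrow> 'y \<Rightarrow> 'y::ab_group_add"
    and pair \<alpha> h +
  fixes scale :: "Qq1 \<Rightarrow> 'u \<Rightarrow> 'u::ring_1"
    and K :: "'y \<Rightarrow> 'u"
    and e f :: "node \<Rightarrow> 'u"
    and T :: "node \<Rightarrow> 'u \<Rightarrow> 'u"
    and star :: "'u \<Rightarrow> 'u"
  assumes presentation: "presented_by scale (case_gen K e f) (relators sY pair \<alpha> h)"
    and T_automorphism: "alg_automorphism scale (T i)"
    and T_K: "T i (K y) = K (y - sY (pair y (\<alpha> i)) (h i))"
    and T_e_same: "T i (e i) = - (f i * K (kdouble sY h i))"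
    and T_f_same: "T i (f i) = - (K (- kdouble sY h i) * e i)"
    and T_e: "j \<noteq> i \<Longrightarrow> T i (e j) =
      (\<Sum>r=0..nat (- cartan i j). scale ((-1) ^ r * qn i powi (- int r))
         (divpow scale i (e i) (nat (- cartan i j) - r) * e j * divpow scale i (e i) r))"
    and T_f: "j \<noteq> i \<Longrightarrow> T i (f j) =
      (\<Sum>r=0..nat (- cartan i j). scale ((-1) ^ r * qn i ^ r)
         (divpow scale i (f i) r * f j * divpow scale i (f i) (nat (- cartan i j) - r)))"
    and star_anti_involution: "alg_anti_involution scale star"
    and star_K: "star (K y) = K (- y)"
    and star_e: "star (e i) = e i"
    and star_f: "star (f i) = f i"


section \<open>Root vectors\<close>

definition Tw :: "(node \<Rightarrow> 'u \<Rightarrow> 'u) \<Rightarrow> 'u \<Rightarrow> 'u" where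
  "Tw T = T N0 \<circ> T N1"

text \<open>\<open>Eplus T e n\<close> is $E_{n\delta+\alpha_1}$ and \<open>Ezero T e n\<close> is $E_{2n\delta+\alpha_0}$, for $n \ge 0$.\<close>

definition Eplus :: "(node \<Rightarrow> 'u \<Rightarrow> 'u) \<Rightarrow> (node \<Rightarrow> 'u) \<Rightarrow> nat \<Rightarrow> 'u" where
  "Eplus T e n = ((inv (T N1) \<circ> inv (T N0)) ^^ n) (e N1)"

definition Ezero :: "(node \<Rightarrow> 'u \<Rightarrow> 'u) \<Rightarrow> (node \<Rightarrow> 'u) \<Rightarrow> nat \<Rightarrow> 'u" where
  "Ezero T e n = ((T N0 \<circ> T N1) ^^ n) (e N0)"

text \<open>
  \<open>Eminus T e m\<close> is $E_{m\delta-\alpha_1}$, indexed by the coefficient $m \ge 1$ of $\delta$;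
  it carries no meaning for $m = 0$.
\<close>

definition Eminus :: "(node \<Rightarrow> 'u \<Rightarrow> 'u) \<Rightarrow> (node \<Rightarrow> 'u) \<Rightarrow> nat \<Rightarrow> 'u" where
  "Eminus T e m = ((T N0 \<circ> T N1) ^^ (m - 1)) (T N0 (e N1))"

definition psi ::
  "(Qq1 \<Rightarrow> 'u \<Rightarrow> 'u::ring_1) \<Rightarrow> (node \<Rightarrow> 'u \<Rightarrow> 'u) \<Rightarrow> (node \<Rightarrow> 'u) \<Rightarrow> nat \<Rightarrow> 'u"
where
  "psi scale T e n =
     (if n = 0 then scale (inverse (q1 - inverse q1)) 1
      else bracket scale (inverse q) (Eminus T e 1) (Eplus T e (n - 1)))"

end

theory Submission
  imports Defs
begin

text \<open>
  The root vectors are points of two orbits of $\tau = T_0T_1$ indexed by all integers: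
  $E_{n\delta+\alpha_1} = \tau^{-n}(e_1)$ and $E_{n\delta-\alpha_1} = \tau^{n}(y_0)$, where
  $y_0 = T_1^{-1}(e_1) = -k_1^{-1}f_1$. Writing $x_n$ and $y_n$ for them, $\tau$ shifts the indices and
  the anti-automorphism $\Omega = T_1^{-1}\ast$ exchanges $x_0$ and $y_0$. All the claims
  follow formally from a handful of identities involving only $x_0$, $x_1$, $y_0$, $y_1$, $e_0$ and
  $\tilde\psi_1$; the locale \<open>A22_loop\<close> records these. In the quantum group they are verified by computing with the string
  $e_0$, $e_1e_0 - q^{-2}e_0e_1$, \<dots> of iterated $q$-commutators with $e_1$: up to scalars, $T_1$ maps
  the mirror images of its members under $\ast$ to the members of the string in reverse order.

  The formal part is an induction on $n$ driven by $\tilde\psi_1$. Its commutator moves $x_n$ to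
  $x_{n+1}$ and $y_n$ to $y_{n+1}$ up to a fixed scalar (\<open>Psi1_X\<close>, \<open>Y_Psi1\<close>). Hence $\Omega$
  exchanges $x_n$ and $y_n$ for every $n \ge 0$, and every relation for the $y_n$ has a
  mirror image for the $x_n$. Applying the commutator with $\tilde\psi_1$ to the formula for
  $[e_0, x_{n-1}]_{q^{-2}}$ yields the one for $[e_0, x_n]_{q^{-2}}$ (\<open>z_X_rel_Suc\<close>). On the other hand
  $e_0$ is proportional to $y_1y_0 - q^{-1}y_0y_1$, and commuting this expression past $x_n$
  expresses the same bracket through $[y_0,\tilde\psi_{n+1}]$ and known terms; comparing the two gives
  the formula for $[y_k,\tilde\psi_{n+1}]$ (\<open>Y_psi_rel_Suc\<close>).

  The crux is that $\tilde\psi_1$ commutes with $\tilde\psi_n$, which is equivalent to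
  $\tau(\tilde\psi_{n+1}) = \tilde\psi_{n+1}$. The brackets
  $[y_k, x_{n+1-k}]_{q^{-1}}$ form an arithmetic progression in $k$, whose
  difference is $-D$, say. Expanding $[\tilde\psi_m, [y_1,x_{n-m}]_{q^{-1}}]$ (\<open>Psi_comm_formula\<close>) gives a recursion
  showing $[\tilde\psi_m,\tilde\psi_{n+1-m}] = c_m D$ for explicit scalars $c_m$. Antisymmetry of the
  commutator then forces $(c_n + c_1)D = 0$, and $c_n + c_1$ is a nonzero rational function, so
  $D = 0$ (\<open>tau_Psi_Suc\<close>).
\<close>

section \<open>Scalars\<close>

lemma q1_conv: "q1 = to_fract [:0, 1:]"
  by (simp add: q1_def to_fract_def)

lemma to_fract_power: "to_fract (x ^ n) = to_fract x ^ n"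
  by (induction n) simp_all

lemma q_conv: "q = to_fract ([:0, 1:] ^ 2)"
  by (simp add: q_def q1_conv to_fract_power)

text \<open>A polynomial in $q_1$ is recognised as nonzero in the ground field by its value at one rational
  number.\<close>

lemma to_fract_nonzero: "poly P x \<noteq> 0 \<Longrightarrow> to_fract P \<noteq> (0 :: Qq1)"
  by auto

lemma q1_nz [simp]: "q1 \<noteq> 0"
  by (simp add: q1_conv)

lemma q_nz [simp]: "q \<noteq> 0"
  by (simp add: q_def)

lemma q_not_1: "q - 1 \<noteq> 0"
  using to_fract_nonzero[of "[:0, 1:] ^ 2 - 1" 2] by (simp add: q_conv)

lemma q_plus_1: "q + 1 \<noteq> 0"
  using to_fract_nonzero[of "[:0, 1:] ^ 2 + 1" 2] by (simp add: q_conv)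

lemma q_cyc6: "1 - q + q^2 \<noteq> 0"
  using to_fract_nonzero[of "1 - [:0, 1:] ^ 2 + ([:0, 1:] ^ 2) ^ 2" 2] by (simp add: q_conv to_fract_power)

lemma q_cyc3: "1 + q + q^2 \<noteq> 0"
  using to_fract_nonzero[of "1 + [:0, 1:] ^ 2 + ([:0, 1:] ^ 2) ^ 2" 2] by (simp add: q_conv to_fract_power)

lemma q_cyc4: "1 + q^2 \<noteq> 0"
  using to_fract_nonzero[of "1 + ([:0, 1:] ^ 2) ^ 2" 2] by (simp add: q_conv to_fract_power)

lemmas q_nonzeros = q_not_1 q_plus_1 q_cyc6 q_cyc3 q_cyc4

lemma q0_nz: "q^2 - inverse (q^2) \<noteq> 0"
proof -
  have "q^2 * (q^2 - inverse (q^2)) = (q - 1) * (q + 1) * (1 + q^2)"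
    by (simp add: field_simps power2_eq_square)
  then show ?thesis using q_nonzeros by auto
qed

definition gq :: Qq1 where "gq = q1 - inverse q1"
definition pq :: Qq1 where "pq = 1 + inverse q"

lemma gq_nz: "gq \<noteq> 0"
proof
  assume "gq = 0"
  then have "q1 * q1 = 1" by (simp add: gq_def field_simps)
  then show False using q_not_1 by (simp add: q_def power2_eq_square)
qed

lemma pq_nz: "pq \<noteq> 0"
  using q_plus_1 by (simp add: pq_def field_simps)

lemma neg_q_powi: "(- q) powi (- int m) = (- 1 / q) ^ m"
proof -
  have "inverse (- q) = - 1 / q" by (simp add: divide_inverse)
  then show ?thesis by (metis power_int_minus power_int_of_nat power_inverse)
qed

lemma bcoef_even: "bcoef (2 * int m) =
    (1 - q) * ((- 1 / q) ^ m - (q^2) ^ m * (q + inverse q)) / (1 - q + q^2)"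
  unfolding bcoef_def Let_def using neg_q_powi[of m] by (simp add: power_int_mult)

lemma bcoef_odd: "bcoef (2 * int m + 1) =
    ((- 1 / q) ^ m + q * (q^2) ^ m * (q - 1)) / (1 - q + q^2)"
proof -
  have d: "(2 * int m + 1) div 2 = int m" by simp
  have "q powi (2 * int m + 1) = q * (q^2)^m"
    by (simp add: power_int_add power_int_mult)
  then show ?thesis unfolding bcoef_def Let_def d neg_q_powi by simp
qed

lemma bcoef_odd_0: "bcoef 1 = 1"
  using bcoef_odd[of 0] q_cyc6 by (simp add: algebra_simps power2_eq_square)

lemma bcoef_even_0: "pq * bcoef 0 = 1 - inverse q ^ 2"
proof -
  have "pq * bcoef 0 * (1 - q + q^2) = (1 - inverse q ^ 2) * (1 - q + q^2)"
    using bcoef_even[of 0] q_cyc6 by (simp add: pq_def) (simp add: field_simps power2_eq_square)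
  then show ?thesis using q_cyc6 by (metis mult_right_cancel)
qed

lemma bcoef_2: "bcoef 2 = q^2 - inverse q"
proof -
  have "bcoef 2 * (1 - q + q^2) = (q^2 - inverse q) * (1 - q + q^2)"
    using bcoef_even[of 1] q_cyc6 by simp (simp add: field_simps power2_eq_square)
  then show ?thesis using q_cyc6 by (metis mult_right_cancel)
qed

lemma bcoef_odd_rec: "bcoef (2 * int (Suc m) + 1) = bcoef (2 * int (Suc m)) - bcoef (2 * int m + 1)"
proof -
  have "- 1 / q * a + q * (q^2 * b) * (q - 1)
      = (1 - q) * (- 1 / q * a - q^2 * b * (q + inverse q)) - (a + q * b * (q - 1))" for a b
    by (simp add: field_simps power2_eq_square)
  then show ?thesis
    unfolding bcoef_odd bcoef_even power_Suc diff_divide_distrib[symmetric] by (rule arg_cong)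
qed

lemma bcoef_even_rec: "pq * bcoef (2 * int (Suc m)) =
    (q^2 - inverse q ^ 2) * bcoef (2 * int m + 1) + (q + 1) * bcoef (2 * int m)"
proof -
  have "(1 + inverse q) * ((1 - q) * (- a / q - q^2 * b * (q + inverse q))) =
    (q^2 - inverse q ^ 2) * (a + q * b * (q - 1)) + (q + 1) * ((1 - q) * (a - b * (q + inverse q)))" for a b
    by (simp add: field_simps power2_eq_square)
  from this[of "(-1/q)^m" "(q^2)^m"] show ?thesis
    unfolding bcoef_odd bcoef_even pq_def
    by (simp add: add_divide_distrib[symmetric])
qed

definition beven :: "nat \<Rightarrow> Qq1" where "beven m = bcoef (2 * int m)"
definition bodd :: "nat \<Rightarrow> Qq1" where "bodd m = bcoef (2 * int m + 1)"

lemma beven_rec: "pq * beven (Suc m) = (q^2 - inverse q ^ 2) * bodd m + (q + 1) * beven m"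
  using bcoef_even_rec[of m] by (simp add: beven_def bodd_def)

lemma bodd_rec: "bodd (Suc m) = beven (Suc m) - bodd m"
  using bcoef_odd_rec[of m] by (simp add: beven_def bodd_def)

lemma bodd_0: "bodd 0 = 1" using bcoef_odd_0 by (simp add: bodd_def)

text \<open>With $g = q_1 - q_1^{-1}$, the scalar \<open>imag_coeff n / gq\<close> will turn out to be the factor $c_n$ in
  $[\tilde\psi_n,\tilde\psi_{N-n}] = c_n D$. As a function of $n$ it is the coefficient of $t^n$ in $t$
  times the logarithmic derivative of $1 + (1+q^{-1})\sum_{n\ge1} b_{2n}t^n$, which is a ratio of products
  of the linear factors $1 - q^{\pm2}t$ and $1 + q^{\pm1}t$.\<close>

definition imag_coeff :: "nat \<Rightarrow> Qq1" where
  "imag_coeff n = (q^2)^n - inverse (q^2) ^ n + (-1/q)^n - (-q)^n"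

text \<open>The factor $t - s$ is kept on the left so that the equation also holds for $s = t$.\<close>

lemma geom_two:
  fixes s t :: "'a::comm_ring_1"
  shows "(t - s) * (\<Sum>i=1..n. s ^ (Suc n - i) * t ^ i) = s * t ^ Suc n - t * s ^ Suc n"
proof (induction n)
  case (Suc n)
  have "(\<Sum>i=1..Suc n. s ^ (Suc (Suc n) - i) * t ^ i)
      = s * (\<Sum>i=1..n. s ^ (Suc n - i) * t ^ i) + s * t ^ Suc n"
    by (simp add: sum_distrib_left Suc_diff_le mult.assoc)
  then have "(t - s) * (\<Sum>i=1..Suc n. s ^ (Suc (Suc n) - i) * t ^ i)
      = s * ((t - s) * (\<Sum>i=1..n. s ^ (Suc n - i) * t ^ i)) + (t - s) * (s * t ^ Suc n)"
    by (simp only: distrib_left mult.left_commute)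
  also have "\<dots> = s * t ^ Suc (Suc n) - t * s ^ Suc (Suc n)"
    unfolding Suc.IH by (simp add: algebra_simps)
  finally show ?case .
qed simp

text \<open>The ratios $r = q^2$, $s = -q^{-1}$ of the progressions in $b_{2m}$, with coefficients $-B$ and $A$,
  and the inverses of these ratios give rise to the geometric sums of \<open>sum_bcoef_imag_coeff\<close>. The
  letters $u$, $u'$, $t$, $w$, $v$ are the inverses of the differences of two ratios; the last four equations
  compare the coefficients of $r^n$, $r^{-n}$, $s^n$ and $s^{-n}$ there.\<close>

lemma partial_fractions:
  fixes q D :: "'a::field"
  assumes nz: "q \<noteq> 0" "D \<noteq> 0" "q + 1 \<noteq> 0" "1 - q \<noteq> 0" "1 + q * q \<noteq> 0"
    and D: "D = 1 - q + q * q"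
  defines "p \<equiv> 1 + 1 / q" and "s \<equiv> - 1 / q" and "r \<equiv> q * q" and "r' \<equiv> 1 / (q * q)"
    and "A \<equiv> (1 - q) / D" and "B \<equiv> (1 - q) / D * (q + 1 / q)"
    and "u \<equiv> q / ((q + 1) * D)" and "u' \<equiv> q * q / (q + 1)" and "t \<equiv> q / ((1 - q) * (q + 1))"
    and "w \<equiv> q * q / ((1 - q) * (q + 1) * (1 + q * q))" and "v \<equiv> - (1 / (q * (q + 1)))"
  shows "(r - s) * u = 1" "(s - r) * - u = 1" "(r' - s) * u' = 1" "(- q - s) * t = 1"
    "(r' - r) * w = 1" "(- q - r) * v = 1"
    "p * (A * s * u - B * r' * w - B * s * u + B * q * v) = - p * B - 1"
    "p * (- A * s * u' + B * r * w) = 1"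
    "p * (- A * r * u + A * r' * u' - A * q * t + B * r * u) = p * A - 1"
    "p * (- A * s * t + B * r * v) = 1"
  unfolding p_def s_def r_def r'_def A_def B_def u_def u'_def t_def w_def v_def
  subgoal using nz by (simp add: divide_simps; use D in algebra)
  subgoal using nz by (simp add: divide_simps; use D in algebra)
  subgoal using nz by (simp add: divide_simps; use D in algebra)
  subgoal
  proof -
    have "(1 - q) * (q + 1) = 1 - q * q" by (simp add: algebra_simps)
    moreover have "(1 - q) * (q + 1) \<noteq> 0" using nz by simp
    ultimately show ?thesis using nz by (simp add: field_simps)
  qed
  subgoal
  proof -
    have d: "(1 - q) * (q + 1) * (1 + q * q) = 1 - q * q * (q * q)" by (simp add: algebra_simps)
    moreover have "(1 - q) * (q + 1) * (1 + q * q) \<noteq> 0" using nz by simp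
    ultimately have "q * q * (q * q) \<noteq> 1" by auto
    then show ?thesis unfolding d using nz(1) by (simp add: divide_simps; simp add: algebra_simps)
  qed
  subgoal
  proof -
    have d: "- q - q * q = - (q * (q + 1))" by (simp add: algebra_simps)
    have "q * (q + 1) \<noteq> 0" using nz by simp
    then show ?thesis unfolding d by (metis minus_mult_minus nonzero_eq_divide_eq mult.commute mult_1_right)
  qed
  subgoal using nz by (simp add: divide_simps; use D in algebra)
  subgoal using nz by (simp add: divide_simps; use D in algebra)
  subgoal using nz by (simp add: divide_simps; use D in algebra)
  subgoal using nz by (simp add: divide_simps; use D in algebra)
  done

text \<open>Both $b_{2m}$ and \<open>imag_coeff m\<close> are linear combinations of geometric progressions, so the convolution
  is a sum of two-ratio geometric sums. Where the two ratios coincide, the sum is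
  $n$ times a power; these terms account for the factor \<open>of_nat (Suc n)\<close> on the right.\<close>

lemma sum_bcoef_imag_coeff:
  "pq * (\<Sum>i=1..n. bcoef (2 * (int (Suc n) - int i)) * imag_coeff i)
     = pq * of_nat (Suc n) * bcoef (2 * int (Suc n)) - imag_coeff (Suc n)"
proof -
  define s r where "s = - 1 / q" and "r = q^2"
  define S where "S x y = (\<Sum>i=1..n. x ^ (Suc n - i) * y ^ i)" for x y :: Qq1
  have imag_coeff: "imag_coeff i = r ^ i - inverse r ^ i + s ^ i - (- q) ^ i" for i
    unfolding imag_coeff_def s_def r_def by simp
  have S: "(y - x) * S x y = x * y ^ Suc n - y * x ^ Suc n" for x y
    unfolding S_def by (rule geom_two)
  have same: "S x x = of_nat n * x ^ Suc n" for x
    unfolding S_def by (simp add: power_add[symmetric])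
  define A where "A = (1 - q) / (1 - q + q^2)"
  define B where "B = A * (q + inverse q)"
  have "u * (x - y * z) / d = u / d * x - u / d * z * y" for u x y z d :: Qq1
    by (simp add: divide_inverse algebra_simps)
  then have b: "bcoef (2 * int m) = A * s ^ m - B * r ^ m" for m
    unfolding bcoef_even A_def B_def s_def r_def by blast
  have "(\<Sum>i=1..n. bcoef (2 * (int (Suc n) - int i)) * imag_coeff i)
      = (\<Sum>i=1..n. (A * s ^ (Suc n - i) - B * r ^ (Suc n - i)) * imag_coeff i)"
    by (intro sum.cong refl) (simp only: b[symmetric], simp)
  also have "\<dots> = A * (S s r - S s (inverse r) + S s s - S s (-q))
                - B * (S r r - S r (inverse r) + S r s - S r (-q))"
    unfolding S_def imag_coeff
    by (simp add: sum_subtractf sum.distrib sum_distrib_left algebra_simps)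
  finally have L: "(\<Sum>i=1..n. bcoef (2 * (int (Suc n) - int i)) * imag_coeff i) = \<dots>" .
  define a e :: Qq1 where "a = q ^ Suc n" and "e = (-1) ^ Suc n"
  have a: "a \<noteq> 0" by (simp add: a_def)
  have pw: "r ^ Suc n = a^2" "inverse r ^ Suc n = inverse a ^ 2" "s ^ Suc n = e * inverse a" "(-q) ^ Suc n = e * a"
    unfolding r_def s_def a_def e_def
    by (simp_all add: power_mult_distrib[symmetric] power_mult[symmetric] power_inverse[symmetric] mult.commute divide_inverse del: power_Suc)
  define D where "D = 1 - q + q^2"
  have nz: "D \<noteq> 0" "q + 1 \<noteq> 0" "1 - q \<noteq> 0" "1 + q * q \<noteq> 0"
    using q_nonzeros by (auto simp: power2_eq_square D_def)
  have inv_r: "inverse r = 1 / (q * q)" and rq: "r = q * q" and pq1: "pq = 1 + 1 / q"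
    and A1: "A = (1 - q) / D" and B1: "B = (1 - q) / D * (q + 1 / q)"
    and D1: "D = 1 - q + q * q"
    by (simp_all add: r_def power2_eq_square pq_def A_def B_def D_def divide_inverse)
  define u u' t w v where "u = q / ((q + 1) * D)" and "u' = q * q / (q + 1)"
    and "t = q / ((1 - q) * (q + 1))" and "w = q * q / ((1 - q) * (q + 1) * (1 + q * q))"
    and "v = - (1 / (q * (q + 1)))"
  note pf = partial_fractions[OF q_nz nz D1, folded u_def u'_def t_def w_def v_def s_def rq inv_r A1 B1 pq1]
  have Sval: "S x y = (x * y ^ Suc n - y * x ^ Suc n) * c" if "(y - x) * c = 1" for x y c
  proof -
    have "S x y = ((y - x) * c) * S x y" using that by simp
    also have "\<dots> = ((y - x) * S x y) * c" by simp
    finally show ?thesis unfolding S .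
  qed
  define X X' Y Y' N where "X = a ^ 2" and "X' = inverse a ^ 2" and "Y = e * inverse a"
    and "Y' = e * a" and "N = (of_nat n :: Qq1)"
  note pw = pw[folded X_def X'_def Y_def Y'_def]
  have N: "of_nat (Suc n) = N + 1" by (simp add: N_def)
  show ?thesis
    unfolding L same imag_coeff[of "Suc n"] b pf(1-6)[THEN Sval] pw N N_def[symmetric]
    using pf(7-10) by algebra
qed

text \<open>Multiplying by $q^{2n}$ clears the denominators; the resulting polynomial in $q$ has constant
  term $-1$ for $n > 1$ and $-2$ for $n = 1$.\<close>

lemma imag_coeff_sum_nonzero: assumes "n \<ge> 1" shows "imag_coeff n + imag_coeff 1 \<noteq> 0"
proof
  assume "imag_coeff n + imag_coeff 1 = 0"
  let ?X = "[:0, 1:] ^ 2 :: rat poly"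
  obtain m where n: "n = Suc m" using assms by (cases n) auto
  define a b e :: Qq1 where "a = q ^ n" and "b = q ^ m" and "e = (-1)^n"
  have ab: "a = q * b" "a \<noteq> 0" by (simp_all add: a_def b_def n)
  have "(q^2)^n = a^2" "inverse (q^2)^n = inverse a ^ 2" "(-1/q)^n = e * inverse a" "(-q)^n = e * a"
    unfolding a_def e_def
    by (simp_all add: power_mult_distrib[symmetric] power_mult[symmetric] power_inverse[symmetric] mult.commute divide_inverse)
  then have gn: "imag_coeff n = a^2 - inverse a ^ 2 + e * inverse a - e * a"
    unfolding imag_coeff_def by simp
  have g1: "imag_coeff 1 = q^2 - inverse q ^ 2 - inverse q + q"
    unfolding imag_coeff_def by (simp add: divide_inverse power_inverse)
  have "0 = a^2 * imag_coeff n + a^2 * imag_coeff 1" using \<open>imag_coeff n + imag_coeff 1 = 0\<close> by (simp add: distrib_left[symmetric])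
  also have "a^2 * imag_coeff n = a^4 - 1 + e * a - e * a^3"
    unfolding gn using ab(2) by (simp add: field_simps power2_eq_square power3_eq_cube power4_eq_xxxx)
  also have "a^2 * imag_coeff 1 = b^2 * (q^4 - 1 - q + q^3)"
    unfolding g1 ab(1) by (simp add: field_simps power2_eq_square power3_eq_cube power4_eq_xxxx)
  also have "a^4 - 1 + e * a - e * a^3 + b^2 * (q^4 - 1 - q + q^3)
      = to_fract ((?X^n)^4 - 1 + (-1)^n * ?X^n - (-1)^n * (?X^n)^3
       + (?X^m)^2 * (?X^4 - 1 - ?X + ?X^3))"
    by (simp add: to_fract_power q_conv e_def a_def b_def)
  finally have "(?X^n)^4 - 1 + (-1)^n * ?X^n - (-1)^n * (?X^n)^3
       + (?X^m)^2 * (?X^4 - 1 - ?X + ?X^3) = 0" by (metis to_fract_eq_0_iff)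
  from arg_cong[OF this, of "\<lambda>P. poly P 0"] show False
    by (cases m) (simp_all add: n)
qed

section \<open>The formal relations of the loop generators\<close>

text \<open>The numeral 1 occurs as an index throughout and should not be turned into \<open>Suc 0\<close>.\<close>

declare One_nat_def [simp del]

context alg
begin

lemmas alg_simps = scale_right_distrib scale_right_diff_distrib scale_minus_right
  scale_mult_left mult_scale_right scale_sum_right sum_distrib_left sum_distrib_right

end

text \<open>For fixed \<open>j\<close> the substitution \<open>i \<mapsto> n + j - i\<close> exchanges the two distances \<open>n - i\<close> and \<open>i - j\<close>.\<close>

lemma sum_triangle_flip:
  fixes F :: "nat \<Rightarrow> nat \<Rightarrow> nat \<Rightarrow> 'a::comm_monoid_add"
  shows "(\<Sum>i<n. \<Sum>j<i. F (n - i) (i - j) j) = (\<Sum>i<n. \<Sum>j<i. F (i - j) (n - i) j)"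
proof -
  have "(\<Sum>i<n. \<Sum>j<i. G i j) = (\<Sum>j<n. \<Sum>i\<in>{j<..<n}. G i j)" for G :: "nat \<Rightarrow> nat \<Rightarrow> 'a"
    by (simp add: sum.Sigma) (rule sum.reindex_bij_witness[of _ "\<lambda>(j,i). (i,j)" "\<lambda>(i,j). (j,i)"]; auto)
  moreover have "(\<Sum>i\<in>{j<..<n}. F (n - i) (i - j) j) = (\<Sum>i\<in>{j<..<n}. F (i - j) (n - i) j)" for j
    by (rule sum.reindex_bij_witness[of _ "\<lambda>i. n + j - i" "\<lambda>i. n + j - i"]) auto
  ultimately show ?thesis by simp
qed

text \<open>\<open>X n\<close> and \<open>Y n\<close> stand for $E_{n\delta+\alpha_1}$ and $E_{n\delta-\alpha_1}$, continued to all integers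
  \<open>n\<close>, and \<open>z\<close> for $e_0$. The expression \<open>bracket scale (inverse q) (Y 1) (X 0)\<close> is $\tilde\psi_1$. Only
  \<open>\<Omega>\<close> on the index 0 is prescribed; its action on the other indices is derived in \<open>Omega_XY\<close>.\<close>

locale A22_loop = alg scale for scale :: "Qq1 \<Rightarrow> 'u \<Rightarrow> 'u::ring_1" +
  fixes X Y :: "int \<Rightarrow> 'u" and z :: 'u and \<tau> \<Omega> :: "'u \<Rightarrow> 'u"
  assumes tau: "alg_automorphism scale \<tau>"
    and tau_X: "\<tau> (X k) = X (k - 1)"
    and tau_Y: "\<tau> (Y k) = Y (k + 1)"
    and Omega_lin: "Vector_Spaces.linear scale scale \<Omega>"
    and Omega_1: "\<Omega> 1 = 1"
    and Omega_mult: "\<Omega> (x * y) = \<Omega> y * \<Omega> x"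
    and Omega_X0: "\<Omega> (X 0) = Y 0"
    and Omega_Y0: "\<Omega> (Y 0) = X 0"
    and tau_psi1: "\<tau> (bracket scale (inverse q) (Y 1) (X 0)) = bracket scale (inverse q) (Y 1) (X 0)"
    and Omega_psi1: "\<Omega> (bracket scale (inverse q) (Y 1) (X 0)) = bracket scale (inverse q) (Y 1) (X 0)"
    and psi1_X0: "bracket scale (inverse q) (Y 1) (X 0) * X 0 = X 0 * bracket scale (inverse q) (Y 1) (X 0) + scale (pq * bcoef 2 / gq) (X 1)"
    and Y0_psi1: "Y 0 * bracket scale (inverse q) (Y 1) (X 0) = bracket scale (inverse q) (Y 1) (X 0) * Y 0 + scale (pq * bcoef 2 / gq) (Y 1)"
    and Y1_Y0: "Y 1 * Y 0 = scale (inverse q) (Y 0 * Y 1) - scale ((q - inverse q ^ 3) / gq) z"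
    and z_X0: "z * X 0 = scale (inverse q ^ 2) (X 0 * z) + Y 1"
    and z_psi1: "z * bracket scale (inverse q) (Y 1) (X 0) = bracket scale (inverse q) (Y 1) (X 0) * z + scale (bcoef 2) (Y 1 * Y 1)"
begin

definition W :: "int \<Rightarrow> int \<Rightarrow> 'u" where
  "W k l = bracket scale (inverse q) (Y k) (X l)"

lemmas tau_W10 = tau_psi1[folded W_def]
  and Omega_W10 = Omega_psi1[folded W_def]
  and W10_X = psi1_X0[folded W_def]
  and Y_W10 = Y0_psi1[folded W_def]
  and z_W10 = z_psi1[folded W_def]

definition Psi :: "nat \<Rightarrow> 'u" where
  "Psi n = (if n = 0 then scale (inverse gq) 1 else W 1 (int n - 1))"

text \<open>This is the scalar by which bracketing with $\tilde\psi_1$ raises the index of \<open>X\<close> and \<open>Y\<close>.\<close>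

definition step_coeff :: Qq1 where "step_coeff = pq * bcoef 2 / gq"

lemma step_coeff_nz: "step_coeff \<noteq> 0"
proof -
  have "bcoef 2 * q = (q - 1) * (1 + q + q^2)"
    unfolding bcoef_2 by (simp add: field_simps power2_eq_square)
  then have "bcoef 2 \<noteq> 0" using q_not_1 q_cyc3 by auto
  then show ?thesis unfolding step_coeff_def using pq_nz gq_nz by simp
qed

lemma W_eq: "Y k * X l = scale (inverse q) (X l * Y k) + W k l"
  by (simp add: W_def bracket_def)

lemma tau_linear: "Vector_Spaces.linear scale scale \<tau>" and tau_1: "\<tau> 1 = 1"
  and tau_mult: "\<tau> (x * y) = \<tau> x * \<tau> y" and tau_bij: "bij \<tau>"
  using tau by (auto simp: alg_automorphism_def)

interpretation tau: Vector_Spaces.linear scale scale \<tau> by (rule tau_linear)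
interpretation Omega: Vector_Spaces.linear scale scale \<Omega> by (rule Omega_lin)

lemma tau_inj: "\<tau> x = \<tau> y \<longleftrightarrow> x = y"
  using tau_bij by (auto simp: bij_def inj_def)

lemma tau_W: "\<tau> (W k l) = W (k + 1) (l - 1)"
  by (simp add: W_def bracket_def tau.diff tau.scale tau_mult tau_X tau_Y)

lemma shift_induct:
  assumes "P (j::int)" "\<And>k. P k \<longleftrightarrow> P (k + 1)" shows "P k"
proof (induction k rule: int_induct[where k = j])
  case base
  show ?case by (fact assms(1))
next
  case (step1 i)
  then show ?case using assms(2) by blast
next
  case (step2 i)
  then show ?case using assms(2)[of "i - 1"] by simp
qed

lemma tau_Psi_0: "\<tau> (Psi 0) = Psi 0"
  by (simp add: Psi_def tau.scale tau_1)

lemma Psi_1: "Psi 1 = W 1 0" by (simp add: Psi_def)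

text \<open>Applying \<open>\<tau>\<close> changes \<open>W k l\<close> into \<open>W (k + 1) (l - 1)\<close>, so invariance of one member of the family with
  fixed \<open>k + l\<close> makes them all equal.\<close>

lemma W_Psi:
  assumes "n \<ge> 1" "\<tau> (Psi n) = Psi n"
  shows "W k (int n - k) = Psi n"
proof (rule shift_induct[where P = "\<lambda>k. W k (int n - k) = Psi n" and j = 1])
  show "W 1 (int n - 1) = Psi n" using assms(1) by (simp add: Psi_def)
next
  fix k
  have "W k (int n - k) = Psi n \<longleftrightarrow> \<tau> (W k (int n - k)) = \<tau> (Psi n)"
    by (rule tau_inj[symmetric])
  also have "\<dots> \<longleftrightarrow> W (k + 1) (int n - (k + 1)) = Psi n"
    by (simp add: tau_W assms(2) algebra_simps)
  finally show "(W k (int n - k) = Psi n) = (W (k + 1) (int n - (k + 1)) = Psi n)" .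
qed

lemma Psi1_X: "Psi 1 * X k = X k * Psi 1 + scale step_coeff (X (k + 1))"
proof (rule shift_induct[where P = "\<lambda>k. Psi 1 * X k = X k * Psi 1 + scale step_coeff (X (k + 1))" and j = 0])
  show "Psi 1 * X 0 = X 0 * Psi 1 + scale step_coeff (X (0 + 1))"
    using W10_X by (simp add: Psi_1 step_coeff_def)
next
  fix k
  show "(Psi 1 * X k = X k * Psi 1 + scale step_coeff (X (k + 1))) \<longleftrightarrow>
    (Psi 1 * X (k + 1) = X (k + 1) * Psi 1 + scale step_coeff (X (k + 1 + 1)))"
    by (subst (2) tau_inj[symmetric])
      (simp add: tau.add tau.scale tau_mult tau_X tau_W10 Psi_1 add.commute)
qed

lemma Y_Psi1: "Y k * Psi 1 = Psi 1 * Y k + scale step_coeff (Y (k + 1))"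
proof (rule shift_induct[where P = "\<lambda>k. Y k * Psi 1 = Psi 1 * Y k + scale step_coeff (Y (k + 1))" and j = 0])
  show "Y 0 * Psi 1 = Psi 1 * Y 0 + scale step_coeff (Y (0 + 1))"
    using Y_W10 by (simp add: Psi_1 step_coeff_def)
next
  fix k
  show "(Y k * Psi 1 = Psi 1 * Y k + scale step_coeff (Y (k + 1))) \<longleftrightarrow>
    (Y (k + 1) * Psi 1 = Psi 1 * Y (k + 1) + scale step_coeff (Y (k + 1 + 1)))"
    by (subst (1) tau_inj[symmetric])
      (simp add: tau.add tau.scale tau_mult tau_Y tau_W10 Psi_1)
qed

text \<open>Each \<open>X (n + 1)\<close> is a commutator of \<open>Psi 1\<close> with \<open>X n\<close>, and likewise for \<open>Y\<close>, with the two
  factors in opposite order. An anti-automorphism fixing \<open>Psi 1\<close> therefore propagates the exchange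
  of \<open>X 0\<close> and \<open>Y 0\<close> upwards.\<close>

lemma Omega_XY: "\<Omega> (X (int n)) = Y (int n)" "\<Omega> (Y (int n)) = X (int n)"
proof (induction n)
  case 0
  show "\<Omega> (X (int 0)) = Y (int 0)" "\<Omega> (Y (int 0)) = X (int 0)"
    by (simp_all add: Omega_X0 Omega_Y0)
next
  case (Suc n)
  have X: "X (int (Suc n)) = scale (inverse step_coeff) (Psi 1 * X (int n) - X (int n) * Psi 1)"
    using step_coeff_nz by (simp add: Psi1_X add.commute)
  have Y: "Y (int (Suc n)) = scale (inverse step_coeff) (Y (int n) * Psi 1 - Psi 1 * Y (int n))"
    using step_coeff_nz by (simp add: Y_Psi1 add.commute)
  have P: "\<Omega> (Psi 1) = Psi 1" by (simp add: Psi_1 Omega_W10)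
  show "\<Omega> (X (int (Suc n))) = Y (int (Suc n))" "\<Omega> (Y (int (Suc n))) = X (int (Suc n))"
    unfolding X Y by (simp_all only: Omega.scale Omega.diff Omega_mult P Suc)
qed

lemma Omega_W: "\<Omega> (W (int k) (int l)) = W (int l) (int k)"
  by (simp add: W_def bracket_def Omega.diff Omega.scale Omega_mult Omega_XY)

text \<open>\<open>\<Omega>\<close> maps \<open>W 1 m\<close> to \<open>W m 1\<close>, which has the same sum of indices.\<close>

lemma Omega_Psi:
  assumes "n \<ge> 1" "\<tau> (Psi n) = Psi n"
  shows "\<Omega> (Psi n) = Psi n"
proof -
  obtain m where m: "n = Suc m" using assms(1) by (cases n) auto
  have "\<Omega> (Psi n) = \<Omega> (W (int 1) (int m))" by (simp add: Psi_def m)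
  also have "\<dots> = W (int m) (int n - int m)" by (simp only: Omega_W) (simp add: m)
  also have "\<dots> = Psi n" by (rule W_Psi[OF assms])
  finally show ?thesis .
qed

text \<open>Bracketing with \<open>Psi 1\<close> is a derivation that raises the index of \<open>X\<close> and, with the opposite sign,
  that of \<open>Y\<close>. In particular \<open>Psi 1\<close> commutes with \<open>W k l\<close> exactly when two
  neighbouring members of the next family agree.\<close>

lemma Psi1_W: "Psi 1 * W k l - W k l * Psi 1 = scale step_coeff (W k (l + 1) - W (k + 1) l)"
proof -
  have Y: "Psi 1 * Y k = Y k * Psi 1 - scale step_coeff (Y (k + 1))"
    by (simp add: Y_Psi1)
  have a: "Psi 1 * (Y k * u) = Y k * (Psi 1 * u) - scale step_coeff (Y (k + 1) * u)" for u
    using Y by (metis mult.assoc left_diff_distrib scale_mult_left)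
  have b: "Psi 1 * (X l * u) = X l * (Psi 1 * u) + scale step_coeff (X (l + 1) * u)" for u
    using Psi1_X by (metis mult.assoc distrib_right scale_mult_left)
  show ?thesis
    unfolding W_def bracket_def
    by (simp add: algebra_simps alg_simps a b Y Psi1_X[of l])
qed

definition Y_psi_rel :: "nat \<Rightarrow> bool" where
  "Y_psi_rel n \<longleftrightarrow> (\<forall>k. Y k * Psi n - Psi n * Y k
     = scale pq (\<Sum>i<n. scale (beven (n - i)) (Psi i * Y (k + int (n - i)))))"

text \<open>The restriction to \<open>k \<ge> 0\<close> comes from \<open>Omega_XY\<close>, through which this relation is obtained.\<close>

definition psi_X_rel :: "nat \<Rightarrow> bool" where
  "psi_X_rel n \<longleftrightarrow> (\<forall>k\<ge>0. Psi n * X k - X k * Psi n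
     = scale pq (\<Sum>i<n. scale (beven (n - i)) (X (k + int (n - i)) * Psi i)))"

definition z_X_rel :: "nat \<Rightarrow> bool" where
  "z_X_rel n \<longleftrightarrow> z * X (int n) - scale (inverse q ^ 2) (X (int n) * z)
     = scale gq (\<Sum>i\<le>n. scale (bodd (n - i)) (Psi i * Y (int (n - i) + 1)))"

lemma Psi_0_comm: "Psi 0 * x = x * Psi 0"
  by (simp add: Psi_def alg_simps)

text \<open>All indices occurring on the two sides are shifted together by \<open>\<tau>\<close>, so one instance suffices.\<close>

lemma Y_psi_rel_all:
  assumes inv: "\<And>i. i \<le> n \<Longrightarrow> \<tau> (Psi i) = Psi i"
   and "Y j * Psi n - Psi n * Y j
     = scale pq (\<Sum>i<n. scale (beven (n - i)) (Psi i * Y (j + int (n - i))))"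
  shows "Y_psi_rel n"
  unfolding Y_psi_rel_def
proof
  let ?P = "\<lambda>k. Y k * Psi n - Psi n * Y k
     = scale pq (\<Sum>i<n. scale (beven (n - i)) (Psi i * Y (k + int (n - i))))"
  have step: "?P k \<longleftrightarrow> ?P (k + 1)" for k
  proof -
    have "\<tau> (\<Sum>i<n. scale (beven (n - i)) (Psi i * Y (k + int (n - i))))
       = (\<Sum>i<n. scale (beven (n - i)) (Psi i * Y (k + 1 + int (n - i))))"
      unfolding tau.sum
      by (intro sum.cong refl) (simp add: tau.scale tau_mult inv tau_Y algebra_simps)
    then show ?thesis
      by (subst (1) tau_inj[symmetric]) (simp add: tau.diff tau.scale tau_mult tau_Y inv)
  qed
  show "?P k" for k
    by (rule shift_induct[where P = ?P and j = j]) (fact assms(2), fact step)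
qed

text \<open>The two relations are mirror images of each other under \<open>\<Omega>\<close>.\<close>

lemma psi_X_rel_from_Y_psi_rel:
  assumes inv: "\<And>i. i \<le> n \<Longrightarrow> \<tau> (Psi i) = Psi i" and r: "Y_psi_rel n"
  shows "psi_X_rel n"
  unfolding psi_X_rel_def
proof (intro allI impI)
  fix k :: int assume "k \<ge> 0"
  then obtain j where k: "k = int j" by (metis nonneg_int_cases)
  have O: "\<Omega> (Psi i) = Psi i" if "i \<le> n" for i
  proof (cases "i = 0")
    case True
    then show ?thesis by (simp add: Psi_def Omega.scale Omega_1)
  qed (use Omega_Psi inv that in auto)
  have "\<Omega> (Y k * Psi n - Psi n * Y k)
      = \<Omega> (scale pq (\<Sum>i<n. scale (beven (n - i)) (Psi i * Y (int (j + (n - i))))))"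
    using r by (simp only: Y_psi_rel_def k of_nat_add)
  then show "Psi n * X k - X k * Psi n
     = scale pq (\<Sum>i<n. scale (beven (n - i)) (X (k + int (n - i)) * Psi i))"
    unfolding k Omega.diff Omega.scale Omega.sum Omega_mult Omega_XY O[OF order_refl]
    by (simp add: O of_nat_diff less_imp_le add_diff_eq cong: sum.cong_simp)
qed

text \<open>Commuting \<open>Psi n\<close> past the two factors of \<open>W 1 l\<close> and regrouping with the definition of \<open>W\<close>
  leaves the displayed sum together with the brackets of the \<open>Psi i\<close>, \<open>i < n\<close>, with \<open>Y 1\<close> and \<open>X l\<close>.
  Expanding these once more gives two double sums that cancel by the symmetry \<open>sum_triangle_flip\<close>.\<close>

lemma Psi_comm_formula:
  assumes r5: "\<And>i. i \<le> n \<Longrightarrow> Y_psi_rel i" and r4: "\<And>i. i \<le> n \<Longrightarrow> psi_X_rel i" and "l \<ge> 0"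
  shows "Psi n * W 1 l - W 1 l * Psi n = scale pq (\<Sum>i<n. scale (beven (n - i))
    (W 1 (l + int (n - i)) * Psi i - Psi i * W (1 + int (n - i)) l))"
proof -
  let ?s = "inverse q"
  have Y: "Y 1 * Psi i - Psi i * Y 1
     = scale pq (\<Sum>j<i. scale (beven (i - j)) (Psi j * Y (1 + int (i - j))))" if "i \<le> n" for i
    using r5[OF that] by (simp add: Y_psi_rel_def)
  have X: "Psi i * X l - X l * Psi i
     = scale pq (\<Sum>j<i. scale (beven (i - j)) (X (l + int (i - j)) * Psi j))" if "i \<le> n" for i
    using r4[OF that] \<open>l \<ge> 0\<close> by (simp add: psi_X_rel_def)
  define SY where "SY = scale pq (\<Sum>j<n. scale (beven (n - j)) (Psi j * Y (1 + int (n - j))))"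
  define SX where "SX = scale pq (\<Sum>j<n. scale (beven (n - j)) (X (l + int (n - j)) * Psi j))"
  have PY: "Psi n * Y 1 = Y 1 * Psi n - SY" using Y[of n] by (simp add: SY_def algebra_simps)
  have PX: "Psi n * X l = X l * Psi n + SX" using X[of n] by (simp add: SX_def algebra_simps)
  have PY': "Psi n * (Y 1 * u) = Y 1 * (Psi n * u) - SY * u" for u
    using PY by (metis mult.assoc left_diff_distrib)
  have PX': "Psi n * (X l * u) = X l * (Psi n * u) + SX * u" for u
    using PX by (metis mult.assoc distrib_right)
  have "Psi n * W 1 l - W 1 l * Psi n = Y 1 * SX - SY * X l + scale ?s (X l * SY) - scale ?s (SX * Y 1)"
    unfolding W_def bracket_def
    by (simp add: algebra_simps alg_simps PY' PX' PY PX)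
  also have "\<dots> = scale pq (\<Sum>i<n. scale (beven (n - i))
      (Y 1 * (X (l + int (n - i)) * Psi i) - Psi i * (Y (1 + int (n - i)) * X l)
       + scale ?s (X l * (Psi i * Y (1 + int (n - i)))) - scale ?s (X (l + int (n - i)) * (Psi i * Y 1))))"
    unfolding SX_def SY_def
    by (simp add: alg_simps sum.distrib sum_subtractf mult.assoc mult.commute mult.left_commute)
  also have "\<dots> = scale pq (\<Sum>i<n. scale (beven (n - i))
      (W 1 (l + int (n - i)) * Psi i - Psi i * W (1 + int (n - i)) l)
      + scale (beven (n - i) * ?s) (X (l + int (n - i)) * (Y 1 * Psi i - Psi i * Y 1)
         - (Psi i * X l - X l * Psi i) * Y (1 + int (n - i))))"
    unfolding W_def bracket_def
    by (intro arg_cong[of _ _ "scale pq"] sum.cong refl)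
       (simp add: alg_simps algebra_simps)
  also have "(\<Sum>i<n. scale (beven (n - i))
      (W 1 (l + int (n - i)) * Psi i - Psi i * W (1 + int (n - i)) l)
      + scale (beven (n - i) * ?s) (X (l + int (n - i)) * (Y 1 * Psi i - Psi i * Y 1)
         - (Psi i * X l - X l * Psi i) * Y (1 + int (n - i)))) 
    = (\<Sum>i<n. scale (beven (n - i))
      (W 1 (l + int (n - i)) * Psi i - Psi i * W (1 + int (n - i)) l))
      + (\<Sum>i<n. scale (beven (n - i) * ?s) (X (l + int (n - i)) * (Y 1 * Psi i - Psi i * Y 1))
          - scale (beven (n - i) * ?s) ((Psi i * X l - X l * Psi i) * Y (1 + int (n - i))))"
    by (simp add: sum.distrib scale_right_diff_distrib)
  also have "(\<Sum>i<n. scale (beven (n - i) * ?s) (X (l + int (n - i)) * (Y 1 * Psi i - Psi i * Y 1))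
          - scale (beven (n - i) * ?s) ((Psi i * X l - X l * Psi i) * Y (1 + int (n - i)))) = 
     (\<Sum>i<n. \<Sum>j<i. scale (beven (n - i) * ?s * pq * beven (i - j)) (X (l + int (n - i)) * Psi j * Y (1 + int (i - j))))
    - (\<Sum>i<n. \<Sum>j<i. scale (beven (n - i) * ?s * pq * beven (i - j)) (X (l + int (i - j)) * Psi j * Y (1 + int (n - i))))"
    unfolding sum_subtractf[symmetric]
    by (intro sum.cong refl) (simp add: X Y alg_simps sum_subtractf mult.assoc)
  also have "\<dots> = 0"
    using sum_triangle_flip[of "\<lambda>a b j. scale (beven a * ?s * pq * beven b) (X (l + int a) * Psi j * Y (1 + int b))" n]
    by (simp add: mult_ac)
  finally show ?thesis by simp
qed

lemma Y_psi_rel_0: "Y_psi_rel 0"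
  by (simp add: Y_psi_rel_def Psi_0_comm)

text \<open>By \<open>Psi1_W\<close> the differences \<open>V k - V (k + 1)\<close> of the family belonging to \<open>Suc n\<close> are all equal
  to one element \<open>D\<close>, proportional to the commutator of \<open>Psi 1\<close> and \<open>Psi n\<close>. The recursion
  \<open>Psi_comm_formula\<close> determines the commutator of \<open>Psi m\<close> and \<open>Psi (Suc n - m)\<close> as a multiple
  of \<open>D\<close>; its solution is \<open>imag_coeff m / gq\<close> by \<open>sum_bcoef_imag_coeff\<close>. The cases \<open>m = 1\<close> and \<open>m = n\<close> concern
  the same two elements in opposite order, which is compatible with \<open>imag_coeff_sum_nonzero\<close> only if \<open>D = 0\<close>.\<close>

lemma tau_Psi_Suc:
  assumes n: "n \<ge> 1" and inv: "\<And>i. i \<le> n \<Longrightarrow> \<tau> (Psi i) = Psi i"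
    and r5: "\<And>i. i \<le> n \<Longrightarrow> Y_psi_rel i" and r4: "\<And>i. i \<le> n \<Longrightarrow> psi_X_rel i"
  shows "Psi 1 * Psi n = Psi n * Psi 1" and "\<tau> (Psi (Suc n)) = Psi (Suc n)"
proof -
  \<comment> \<open>The family whose first member is \<open>Psi (Suc n)\<close>.\<close>
  define V where "V k = W k (int (Suc n) - k)" for k
  define D where "D = V 1 - V 2"
  have step: "Psi 1 * Psi n - Psi n * Psi 1 = scale step_coeff (V k - V (k + 1))" for k
    using Psi1_W[of k "int n - k"] W_Psi[OF n inv, of k] by (simp add: V_def algebra_simps)
  have D: "V k - V (k + 1) = D" for k
  proof -
    have "scale step_coeff (V k - V (k + 1)) = scale step_coeff (V 1 - V (1 + 1))"
      using step[of k] step[of 1] by metis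
    then show ?thesis using step_coeff_nz by (simp add: D_def)
  qed
  have D_mult: "V 1 - V (1 + int m) = scale (of_nat m) D" for m
  proof (induction m)
    case (Suc m)
    have "V 1 - V (1 + int (Suc m)) = (V 1 - V (1 + int m)) + D"
      using D[of "1 + int m"] by (simp add: algebra_simps)
    then show ?case by (simp add: Suc scale_left_distrib)
  qed simp
  have comm: "scale gq (Psi m * Psi (Suc n - m) - Psi (Suc n - m) * Psi m) = scale (imag_coeff m) D"
    if "1 \<le> m" "m \<le> n" for m
    using that
  proof (induction m rule: less_induct)
    case (less m)
    obtain m' where m': "m = Suc m'" using less.prems by (cases m) auto
    define l where "l = int (n - m)"
    have W1l: "W 1 l = Psi (Suc n - m)" "l \<ge> 0"
      unfolding l_def using W_Psi[of "Suc n - m" 1] inv[of "Suc n - m"] less.prems 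
      by (simp_all add: of_nat_diff)
    have "Psi m * W 1 l - W 1 l * Psi m = scale pq (\<Sum>i<m. scale (beven (m - i))
       (W 1 (l + int (m - i)) * Psi i - Psi i * W (1 + int (m - i)) l))"
      using r5 r4 less.prems W1l(2) by (intro Psi_comm_formula) auto
    \<comment> \<open>The term with \<open>i = 0\<close> compares two members of the family \<open>V\<close> at distance \<open>m\<close>, because
      \<open>Psi 0\<close> is a scalar; the other terms are commutators of smaller index.\<close>
    also have "(\<Sum>i<m. scale (beven (m - i))
       (W 1 (l + int (m - i)) * Psi i - Psi i * W (1 + int (m - i)) l))
       = scale (beven m) (scale (inverse gq) (V 1 - V (1 + int m))) + 
       (\<Sum>i=1..m'. scale (beven (m - i))
       (W 1 (l + int (m - i)) * Psi i - Psi i * W (1 + int (m - i)) l))"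
    proof -
      have "{..<m} = insert 0 {1..m'}" by (auto simp: m')
      moreover have "W 1 (l + int m) = V 1" "W (1 + int m) l = V (1 + int m)"
        unfolding V_def l_def using less.prems by (simp_all add: of_nat_diff)
      ultimately show ?thesis by (simp add: Psi_def alg_simps)
    qed
    also have "(\<Sum>i=1..m'. scale (beven (m - i))
       (W 1 (l + int (m - i)) * Psi i - Psi i * W (1 + int (m - i)) l))
       = (\<Sum>i=1..m'. scale (beven (m - i)) (- scale (inverse gq) (scale (imag_coeff i) D)))"
    proof (intro sum.cong refl arg_cong[of _ _ "scale _"])
      fix i assume i: "i \<in> {1..m'}"
      have e: "l + int (m - i) = int (Suc n - i) - 1" "l = int (Suc n - i) - (1 + int (m - i))"
        using i less.prems by (auto simp: l_def m' of_nat_diff)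
      have "W k (int (Suc n - i) - k) = Psi (Suc n - i)" for k
        using i less.prems by (intro W_Psi inv) (auto simp: m')
      then have "W 1 (l + int (m - i)) = Psi (Suc n - i)" "W (1 + int (m - i)) l = Psi (Suc n - i)"
        unfolding e(1) by (simp, subst e(2), simp)
      moreover have "scale gq (Psi i * Psi (Suc n - i) - Psi (Suc n - i) * Psi i) = scale (imag_coeff i) D"
        using i less.prems by (intro less.IH) (auto simp: m')
      then have "scale (inverse gq) (scale gq (Psi i * Psi (Suc n - i) - Psi (Suc n - i) * Psi i))
         = scale (inverse gq) (scale (imag_coeff i) D)" by (rule arg_cong)
      then have "Psi i * Psi (Suc n - i) - Psi (Suc n - i) * Psi i = scale (inverse gq) (scale (imag_coeff i) D)"
        using gq_nz by simp
      ultimately show "W 1 (l + int (m - i)) * Psi i - Psi i * W (1 + int (m - i)) l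
          = - scale (inverse gq) (scale (imag_coeff i) D)" by (simp add: algebra_simps)
    qed
    also have "\<dots> = scale (- inverse gq * (\<Sum>i=1..m'. beven (m - i) * imag_coeff i)) D"
      by (simp add: scale_sum_left sum_distrib_left mult_ac sum_negf)
    finally have "Psi m * W 1 l - W 1 l * Psi m
        = scale (inverse gq * (pq * beven m * of_nat m - pq * (\<Sum>i=1..m'. beven (m - i) * imag_coeff i))) D"
      by (simp add: D_mult scale_left_diff_distrib scale_right_distrib scale_right_diff_distrib
          right_diff_distrib mult_ac)
    then have "scale gq (Psi m * W 1 l - W 1 l * Psi m)
        = scale (gq * inverse gq * (pq * beven m * of_nat m - pq * (\<Sum>i=1..m'. beven (m - i) * imag_coeff i))) D"
      by (simp only: scale_scale mult.assoc)
    also have "gq * inverse gq = 1" using gq_nz by simp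
    also have "(\<Sum>i=1..m'. beven (m - i) * imag_coeff i) = (\<Sum>i=1..m'. bcoef (2 * (int (Suc m') - int i)) * imag_coeff i)"
      by (intro sum.cong refl) (simp add: beven_def m' of_nat_diff)
    finally show ?case
      using sum_bcoef_imag_coeff[of m'] by (simp add: W1l(1) beven_def m')
  qed
  have "scale gq (Psi 1 * Psi n - Psi n * Psi 1) = scale (imag_coeff 1) D"
    using comm[of 1] n by simp
  moreover have "scale gq (Psi n * Psi 1 - Psi 1 * Psi n) = scale (imag_coeff n) D"
    using comm[of n] n by (simp add: Suc_diff_le One_nat_def)
  ultimately have "scale (imag_coeff n + imag_coeff 1) D = 0"
    by (simp add: scale_left_distrib scale_right_diff_distrib flip: \<open>scale gq (Psi n * Psi 1 - Psi 1 * Psi n) = scale (imag_coeff n) D\<close>)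
      (simp add: algebra_simps flip: \<open>scale gq (Psi 1 * Psi n - Psi n * Psi 1) = scale (imag_coeff 1) D\<close>)
  then have "D = 0" using imag_coeff_sum_nonzero[OF n] by simp
  then show "Psi 1 * Psi n = Psi n * Psi 1" using step[of 1] D[of 1] by simp
  have "\<tau> (Psi (Suc n)) = V 2" "Psi (Suc n) = V 1"
    by (simp_all add: Psi_def tau_W V_def)
  then show "\<tau> (Psi (Suc n)) = Psi (Suc n)" using \<open>D = 0\<close> by (simp add: D_def)
qed

lemma z_X_rel_0: "z_X_rel 0"
  using z_X0 gq_nz by (simp add: z_X_rel_def Psi_def bodd_0 alg_simps)

text \<open>Bracket \<open>z_X_rel n\<close> with \<open>Psi 1\<close>. On the left this raises the index of \<open>X\<close> and produces a term with
  the square of \<open>Y 1\<close>, which the relations of \<open>Y 1\<close> with \<open>X n\<close> and with \<open>Psi (Suc n)\<close> turn into a sum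
  of the required shape; on the right it only raises the index of \<open>Y\<close>. The coefficients match by
  \<open>bodd_rec\<close>.\<close>

lemma z_X_rel_Suc:
  assumes r7: "z_X_rel n" and r5: "Y_psi_rel (Suc n)"
    and comm: "\<And>i. i \<le> n \<Longrightarrow> Psi 1 * Psi i = Psi i * Psi 1"
  shows "z_X_rel (Suc n)"
proof -
  let ?P = "Psi 1" and ?s = "inverse q"
  define R where "R = (\<Sum>i\<le>n. scale (bodd (n - i)) (Psi i * Y (int (n - i) + 1)))"
  define R' where "R' = (\<Sum>i\<le>n. scale (bodd (n - i)) (Psi i * Y (int (Suc n - i) + 1)))"
  have zP: "?P * z = z * ?P - scale (bcoef 2) (Y 1 * Y 1)"
    using z_W10 by (simp add: Psi_1)
  have zP': "?P * (z * u) = z * (?P * u) - scale (bcoef 2) (Y 1 * (Y 1 * u))" for u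
    using zP by (simp only: mult.assoc[symmetric] zP left_diff_distrib scale_mult_left)
  have PX: "?P * X (int n) = X (int n) * ?P + scale step_coeff (X (int (Suc n)))"
    using Psi1_X by (simp add: add.commute)
  have PX': "?P * (X (int n) * u) = X (int n) * (?P * u) + scale step_coeff (X (int (Suc n)) * u)" for u
    using PX by (simp only: mult.assoc[symmetric] PX distrib_right scale_mult_left)
  have E1: "?P * (z * X (int n) - scale (?s ^ 2) (X (int n) * z)) - (z * X (int n) - scale (?s ^ 2) (X (int n) * z)) * ?P
     = scale step_coeff (z * X (int (Suc n)) - scale (?s ^ 2) (X (int (Suc n)) * z))
      - scale (bcoef 2) (Y 1 * Y 1 * X (int n) - scale (?s^2) (X (int n) * Y 1 * Y 1))"
    by (simp add: algebra_simps alg_simps zP zP' PX PX')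
  have E2: "?P * (z * X (int n) - scale (?s ^ 2) (X (int n) * z)) - (z * X (int n) - scale (?s ^ 2) (X (int n) * z)) * ?P
     = scale gq (?P * R - R * ?P)"
    using r7 unfolding z_X_rel_def R_def[symmetric] by (simp add: alg_simps)
  have E3: "?P * R - R * ?P = - scale step_coeff R'"
  proof -
    have "?P * (Psi i * Y (int (n - i) + 1)) - Psi i * Y (int (n - i) + 1) * ?P
        = - scale step_coeff (Psi i * Y (int (Suc n - i) + 1))" if "i \<le> n" for i
    proof -
      have "?P * (Psi i * u) = Psi i * (?P * u)" for u
        by (simp only: mult.assoc[symmetric] comm[OF that])
      moreover have "Y (int (n - i) + 1) * ?P = ?P * Y (int (n - i) + 1) + scale step_coeff (Y (int (Suc n - i) + 1))"
        using Y_Psi1[of "int (n - i) + 1"] that by (simp add: Suc_diff_le add_ac)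
      ultimately show ?thesis by (simp add: algebra_simps alg_simps)
    qed
    then have "(\<Sum>i\<le>n. scale (bodd (n - i)) (?P * (Psi i * Y (int (n - i) + 1)) - Psi i * Y (int (n - i) + 1) * ?P))
      = (\<Sum>i\<le>n. scale (bodd (n - i)) (- scale step_coeff (Psi i * Y (int (Suc n - i) + 1))))"
      by (intro sum.cong refl) simp
    moreover have "?P * R - R * ?P
      = (\<Sum>i\<le>n. scale (bodd (n - i)) (?P * (Psi i * Y (int (n - i) + 1)) - Psi i * Y (int (n - i) + 1) * ?P))"
      unfolding R_def by (simp add: alg_simps sum_subtractf)
    moreover have "- scale step_coeff R' = (\<Sum>i\<le>n. scale (bodd (n - i)) (- scale step_coeff (Psi i * Y (int (Suc n - i) + 1))))"
      unfolding R'_def by (simp add: alg_simps sum_negf mult.commute)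
    ultimately show ?thesis by simp
  qed
  have E4: "Y 1 * Y 1 * X (int n) - scale (?s^2) (X (int n) * Y 1 * Y 1) = 
     Y 1 * Psi (Suc n) + scale ?s (Psi (Suc n) * Y 1)"
  proof -
    have Y: "Y 1 * X (int n) = scale ?s (X (int n) * Y 1) + Psi (Suc n)"
      using W_eq[of 1 "int n"] by (simp add: Psi_def)
    have "Y 1 * (X (int n) * u) = scale ?s (X (int n) * (Y 1 * u)) + Psi (Suc n) * u" for u
      by (simp only: mult.assoc[symmetric] Y distrib_right scale_mult_left)
    with Y show ?thesis by (simp add: algebra_simps alg_simps power2_eq_square)
  qed
  define Q where "Q = (\<Sum>i<Suc n. scale (beven (Suc n - i)) (Psi i * Y (1 + int (Suc n - i))))"
  have E5: "Y 1 * Psi (Suc n) = Psi (Suc n) * Y 1 + scale pq Q"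
    using r5 by (simp only: Y_psi_rel_def Q_def diff_eq_eq add.commute)
  have "scale step_coeff (z * X (int (Suc n)) - scale (?s ^ 2) (X (int (Suc n)) * z))
     = scale gq (?P * R - R * ?P)
       + scale (bcoef 2) (Y 1 * Y 1 * X (int n) - scale (?s^2) (X (int n) * Y 1 * Y 1))"
    using trans[OF E1[symmetric] E2] by (simp only: diff_eq_eq)
  also have "\<dots> = scale (bcoef 2) (scale pq (Psi (Suc n) * Y 1) + scale pq Q) - scale gq (scale step_coeff R')"
    unfolding E3 E4 E5 by (simp add: pq_def scale_left_distrib algebra_simps)
  also have "\<dots> = scale step_coeff (scale gq (Psi (Suc n) * Y 1 + Q - R'))"
    using gq_nz by (simp add: step_coeff_def algebra_simps)
  finally have "z * X (int (Suc n)) - scale (?s ^ 2) (X (int (Suc n)) * z) = scale gq (Psi (Suc n) * Y 1 + Q - R')"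
    using step_coeff_nz by (simp only: scale_cancel_left) simp
  also have "Psi (Suc n) * Y 1 + Q - R' = (\<Sum>i\<le>Suc n. scale (bodd (Suc n - i)) (Psi i * Y (int (Suc n - i) + 1)))"
  proof -
    have "Q - R' = (\<Sum>i\<le>n. scale (bodd (Suc n - i)) (Psi i * Y (int (Suc n - i) + 1)))"
      unfolding Q_def R'_def lessThan_Suc_atMost sum_subtractf[symmetric]
      by (intro sum.cong refl)
        (simp add: Suc_diff_le bodd_rec scale_left_diff_distrib add.commute)
    then show ?thesis by (simp add: bodd_0 algebra_simps)
  qed
  finally show ?thesis unfolding z_X_rel_def .
qed

text \<open>The bracket of \<open>z\<close> with \<open>X n\<close> is known from \<open>z_X_rel n\<close>. Computed from the expression of \<open>z\<close> as a
  combination of \<open>Y 1 * Y 0\<close> and \<open>Y 0 * Y 1\<close>, it involves the bracket of \<open>Y 0\<close> with \<open>Psi (Suc n)\<close> and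
  otherwise only terms covered by \<open>Y_psi_rel n\<close>; solving for that bracket gives the case \<open>k = 0\<close>. The
  coefficients match by \<open>beven_rec\<close>.\<close>

lemma Y_psi_rel_Suc:
  assumes n: "n \<ge> 1" and r7: "z_X_rel n" and r5: "Y_psi_rel n" and inv: "\<And>i. i \<le> Suc n \<Longrightarrow> \<tau> (Psi i) = Psi i"
  shows "Y_psi_rel (Suc n)"
proof (rule Y_psi_rel_all[OF inv])
  let ?s = "inverse q" and ?P = "Psi n" and ?P' = "Psi (Suc n)" and ?x = "X (int n)"
  define R where "R = (\<Sum>i\<le>n. scale (bodd (n - i)) (Psi i * Y (int (n - i) + 1)))"
  define Q where "Q = (\<Sum>i<n. scale (beven (n - i)) (Psi i * Y (1 + int (n - i))))"
  have Y1: "Y 1 * ?x = scale ?s (?x * Y 1) + ?P'"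
    using W_eq[of 1 "int n"] by (simp add: Psi_def)
  then have Y1': "Y 1 * (?x * u) = scale ?s (?x * (Y 1 * u)) + ?P' * u" for u
    by (metis mult.assoc distrib_right scale_mult_left)
  have Y0: "Y 0 * ?x = scale ?s (?x * Y 0) + ?P"
    using W_eq[of 0 "int n"] W_Psi[of n 0] n inv[of n] by simp
  then have Y0': "Y 0 * (?x * u) = scale ?s (?x * (Y 0 * u)) + ?P * u" for u
    by (metis mult.assoc distrib_right scale_mult_left)
  define \<kappa> where "\<kappa> = (q - ?s ^ 3) / gq"
  have "scale \<kappa> z = scale ?s (Y 0 * Y 1) - Y 1 * Y 0"
    using Y1_Y0 by (simp add: \<kappa>_def algebra_simps)
  moreover have "scale \<kappa> (z * ?x - scale (?s ^ 2) (?x * z)) = scale \<kappa> z * ?x - scale (?s ^ 2) (?x * scale \<kappa> z)"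
    by (simp add: alg_simps mult.commute)
  ultimately have "scale \<kappa> (z * ?x - scale (?s ^ 2) (?x * z))
     = (scale ?s (Y 0 * Y 1) - Y 1 * Y 0) * ?x - scale (?s^2) (?x * (scale ?s (Y 0 * Y 1) - Y 1 * Y 0))"
    by simp
  also have "\<dots> = scale ?s (Y 0 * ?P') + scale (?s * ?s) (?P * Y 1) - Y 1 * ?P - scale ?s (?P' * Y 0)"
    by (simp add: algebra_simps alg_simps Y1 Y1' Y0 Y0' power2_eq_square)
  also have "z * ?x - scale (?s ^ 2) (?x * z) = scale gq R"
    using r7 by (simp add: z_X_rel_def R_def)
  also have "Y 1 * ?P = ?P * Y 1 + scale pq Q"
    using r5 by (simp only: Y_psi_rel_def Q_def diff_eq_eq add.commute)
  finally have "scale ?s (Y 0 * ?P' - ?P' * Y 0) = scale \<kappa> (scale gq R) + scale (1 - ?s * ?s) (?P * Y 1) + scale pq Q"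
    by (simp add: algebra_simps scale_left_diff_distrib)
  then have "scale q (scale ?s (Y 0 * ?P' - ?P' * Y 0)) = scale q (scale \<kappa> (scale gq R) + scale (1 - ?s * ?s) (?P * Y 1) + scale pq Q)"
    by (rule arg_cong)
  then have "Y 0 * ?P' - ?P' * Y 0 = scale (q * (\<kappa> * gq)) R + scale (q * (1 - ?s^2)) (?P * Y 1) + scale (q * pq) Q"
    by (simp add: scale_right_distrib power2_eq_square mult.assoc)
  also have "q * (\<kappa> * gq) = q^2 - ?s^2"
  proof -
    have "\<kappa> * gq = q - ?s ^ 3" using gq_nz by (simp add: \<kappa>_def)
    then show ?thesis by (simp add: right_diff_distrib power2_eq_square power3_eq_cube)
  qed
  also have "1 - ?s^2 = pq * beven 0" using bcoef_even_0 by (simp add: beven_def)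
  also have "q * pq = q + 1" by (simp add: pq_def distrib_left)
  also have "q * (pq * beven 0) = (q + 1) * beven 0" by (simp add: pq_def distrib_left distrib_right)
  also have "scale (q^2 - ?s^2) R + scale ((q + 1) * beven 0) (?P * Y 1) + scale (q + 1) Q
     = (\<Sum>i\<le>n. scale ((q^2 - ?s^2) * bodd (n - i) + (q + 1) * beven (n - i)) (Psi i * Y (1 + int (n - i))))"
  proof -
    have "scale ((q + 1) * beven 0) (?P * Y 1) + scale (q + 1) Q 
     = (\<Sum>i\<le>n. scale ((q + 1) * beven (n - i)) (Psi i * Y (1 + int (n - i))))"
      unfolding Q_def lessThan_Suc_atMost[symmetric]
      by (simp add: scale_sum_right)
    moreover have "scale (q^2 - ?s^2) R = (\<Sum>i\<le>n. scale ((q^2 - ?s^2) * bodd (n - i)) (Psi i * Y (1 + int (n - i))))"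
      unfolding R_def by (simp add: scale_sum_right add.commute)
    ultimately show ?thesis by (simp only: scale_left_distrib sum.distrib add.assoc)
  qed
  also have "\<dots> = scale pq (\<Sum>i<Suc n. scale (beven (Suc n - i)) (Psi i * Y (0 + int (Suc n - i))))"
    unfolding lessThan_Suc_atMost scale_sum_right
    by (intro sum.cong refl) (simp add: beven_rec[symmetric] Suc_diff_le)
  finally show "Y 0 * ?P' - ?P' * Y 0
    = scale pq (\<Sum>i<Suc n. scale (beven (Suc n - i)) (Psi i * Y (0 + int (Suc n - i))))" .
qed

lemma Psi_0: "Psi 0 = scale (inverse gq) 1"
  by (simp add: Psi_def)

lemma Y_psi_rel_1: "Y_psi_rel 1"
proof (rule Y_psi_rel_all)
  show "\<tau> (Psi i) = Psi i" if "i \<le> 1" for i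
    using that tau_Psi_0 tau_W10 Psi_1 by (cases "i = 0") (auto simp: le_Suc_eq One_nat_def)
  show "Y 0 * Psi 1 - Psi 1 * Y 0 = scale pq (\<Sum>i<1. scale (beven (1 - i)) (Psi i * Y (0 + int (1 - i))))"
    by (simp add: Y_Psi1 lessThan_Suc step_coeff_def beven_def Psi_0 divide_inverse mult.assoc alg_simps)
qed

text \<open>The invariance of \<open>Psi\<close> and its bracket with \<open>Y\<close> run one step ahead of the other two relations.\<close>

theorem loop_relations:
  "z_X_rel n \<and> (\<forall>i\<le>Suc n. \<tau> (Psi i) = Psi i \<and> Y_psi_rel i) \<and> (\<forall>i\<le>n. Psi 1 * Psi i = Psi i * Psi 1)"
proof (induction n)
  case 0
  have "\<tau> (Psi i) = Psi i \<and> Y_psi_rel i" if "i \<le> Suc 0" for i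
    using that tau_Psi_0 tau_W10 Psi_1 Y_psi_rel_0 Y_psi_rel_1
    by (cases "i = 0") (auto simp: le_Suc_eq One_nat_def)
  then show ?case using z_X_rel_0 by (simp add: Psi_0_comm)
next
  case (Suc n)
  have inv: "\<tau> (Psi i) = Psi i" and r5: "Y_psi_rel i" if "i \<le> Suc n" for i
    using Suc.IH that by auto
  have r4: "psi_X_rel i" if "i \<le> Suc n" for i
    using that by (intro psi_X_rel_from_Y_psi_rel inv r5) auto
  have c: "Psi 1 * Psi (Suc n) = Psi (Suc n) * Psi 1"
    and t: "\<tau> (Psi (Suc (Suc n))) = Psi (Suc (Suc n))"
    using tau_Psi_Suc[of "Suc n"] inv r5 r4 by auto
  have inv': "\<tau> (Psi i) = Psi i" if "i \<le> Suc (Suc n)" for i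
    using inv t that by (cases "i = Suc (Suc n)") auto
  have r7: "z_X_rel (Suc n)" using Suc.IH by (intro z_X_rel_Suc) auto
  have "Y_psi_rel (Suc (Suc n))" using Y_psi_rel_Suc[of "Suc n"] r7 r5 inv' by auto
  then have "\<forall>i\<le>Suc (Suc n). \<tau> (Psi i) = Psi i \<and> Y_psi_rel i"
    using inv' r5 le_Suc_eq by auto
  moreover have "\<forall>i\<le>Suc n. Psi 1 * Psi i = Psi i * Psi 1"
    using Suc.IH c le_Suc_eq by auto
  ultimately show ?case using r7 by blast
qed

end

section \<open>The defining relations in the presented algebra\<close>

context alg
begin

lemma feval_on:
  assumes "finite A" "Poly_Mapping.keys p \<subseteq> A"
  shows "feval scale v p = (\<Sum>w\<in>A. scale (Poly_Mapping.lookup p w) (prod_list (map v (letters w))))"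
  unfolding feval_def
  by (rule sum.mono_neutral_left) (use assms in \<open>auto simp: in_keys_iff\<close>)

lemma feval_add: "feval scale v (p + r) = feval scale v p + feval scale v r"
proof -
  let ?A = "Poly_Mapping.keys p \<union> Poly_Mapping.keys r"
  have "Poly_Mapping.keys (p + r) \<subseteq> ?A" by (rule Poly_Mapping.keys_add)
  then show ?thesis
    by (simp add: feval_on[of ?A] lookup_add scale_left_distrib sum.distrib)
qed

lemma feval_0: "feval scale v 0 = 0"
  by (simp add: feval_def)

lemma feval_uminus: "feval scale v (- p) = - feval scale v p"
  using feval_add[of v p "- p"] by (simp add: feval_0 minus_unique)

lemma feval_diff: "feval scale v (p - r) = feval scale v p - feval scale v r"
  using feval_add[of v p "- r"] by (simp add: feval_uminus)

lemma feval_single: "feval scale v (Poly_Mapping.single w c) = scale c (prod_list (map v (letters w)))"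
  by (cases "c = 0") (simp_all add: feval_def)

lemma poly_mapping_monomial_induct:
  fixes p :: "'a \<Rightarrow>\<^sub>0 'b::monoid_add"
  assumes "P 0" "\<And>p w c. P p \<Longrightarrow> P (p + Poly_Mapping.single w c)"
  shows "P p"
proof (induction p rule: update_induct)
  case (update f a b)
  have "Poly_Mapping.update a b f = f + Poly_Mapping.single a b"
    using update(1) by (intro poly_mapping_eqI) (auto simp: lookup_add lookup_update lookup_single in_keys_iff when_def)
  then show ?case using assms(2) update by simp
qed (fact assms(1))

lemma feval_mult: "feval scale v (p * r) = feval scale v p * feval scale v r"
proof (induction p rule: poly_mapping_monomial_induct)
  case (2 p w c)
  have "feval scale v (Poly_Mapping.single w c * r) = feval scale v (Poly_Mapping.single w c) * feval scale v r"
    by (induction r rule: poly_mapping_monomial_induct)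
      (simp_all add: feval_0 distrib_left feval_add feval_single mult_single alg_simps plus_word_def)
  with 2 show ?case by (simp add: distrib_right feval_add)
qed (simp add: feval_0)

lemma feval_1: "feval scale v 1 = 1"
proof -
  have "feval scale v (Poly_Mapping.single 0 1) = 1"
    by (simp only: feval_single) (simp add: zero_word_def)
  then show ?thesis by simp
qed

lemma feval_fgen: "feval scale v (fgen g) = v g"
  by (simp add: fgen_def feval_single)

lemma feval_fscale: "feval scale v (fscale c p) = scale c (feval scale v p)"
  by (simp add: fscale_def feval_mult feval_single alg_simps zero_word_def)

lemma feval_power: "feval scale v (p ^ n) = feval scale v p ^ n"
  by (induction n) (simp_all add: feval_1 feval_mult)

lemma feval_sum: "feval scale v (\<Sum>i\<in>A. p i) = (\<Sum>i\<in>A. feval scale v (p i))"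
  by (induction A rule: infinite_finite_induct) (simp_all add: feval_0 feval_add)

lemmas feval_hom = feval_add feval_0 feval_uminus feval_diff feval_mult feval_1 feval_fgen
  feval_fscale feval_power feval_sum

lemma feval_serre: "feval scale v (serre fscale (\<lambda>i. fgen (G i)) i j) = serre scale (\<lambda>i. v (G i)) i j"
  by (simp add: serre_def divpow_def feval_hom)

end

context quantum_A22
begin

sublocale alg scale
  using presentation by (simp add: presented_by_def)

lemma relator_zero:
  assumes "r \<in> relators sY pair \<alpha> h" shows "feval scale (case_gen K e f) r = 0"
proof -
  have "1 * r * 1 \<in> two_sided_ideal (relators sY pair \<alpha> h)" using assms by (rule two_sided_ideal.gen)
  then show ?thesis using presentation by (auto simp: presented_by_def)
qed

lemma K_0: "K 0 = 1"
  using relator_zero[of "fgen (GenK 0) - 1"]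
  by (simp add: relators_def Let_def feval_hom)

lemma K_add: "K (y + y') = K y * K y'"
  using relator_zero[of "fgen (GenK y) * fgen (GenK y') - fgen (GenK (y + y'))"]
  by (force simp add: relators_def Let_def feval_hom)

lemma K_inverse: "K y * K (- y) = 1" "K (- y) * K y = 1"
  using K_add[of y "- y"] K_add[of "- y" y] by (simp_all add: K_0)

lemma K_e: "K y * e i = scale (q1 powi pair y (\<alpha> i)) (e i * K y)"
proof -
  have "K y * e i * K (- y) = scale (q1 powi pair y (\<alpha> i)) (e i)"
    using relator_zero[of "fgen (GenK y) * fgen (GenE i) * fgen (GenK (- y)) - fscale (q1 powi pair y (\<alpha> i)) (fgen (GenE i))"]
    by (force simp add: relators_def Let_def feval_hom)
  then have "K y * e i * K (- y) * K y = scale (q1 powi pair y (\<alpha> i)) (e i) * K y" by simp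
  then show ?thesis by (simp add: mult.assoc K_inverse scale_mult_left)
qed

lemma e_f: "e i * f j - f j * e i =
  (if i = j then scale (inverse (qn i - inverse (qn i))) (K (kdouble sY h i) - K (- kdouble sY h i)) else 0)"
proof -
  let ?r = "fgen (GenE i) * fgen (GenF j) - fgen (GenF j) * fgen (GenE i)
          - (if i = j
             then fscale (inverse (qn i - inverse (qn i)))
                    (fgen (GenK (kdouble sY h i)) - fgen (GenK (- kdouble sY h i)))
             else 0)"
  have "?r \<in> relators sY pair \<alpha> h" unfolding relators_def Let_def by blast
  from relator_zero[OF this] show ?thesis by (simp add: feval_hom split: if_splits)
qed

lemma serre_e: "i \<noteq> j \<Longrightarrow> serre scale e i j = 0"
proof -
  assume "i \<noteq> j"
  then have "serre fscale (\<lambda>i. fgen (GenE i)) i j \<in> relators sY pair \<alpha> h"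
    unfolding relators_def Let_def by blast
  from relator_zero[OF this] show ?thesis by (simp add: feval_serre)
qed

lemma pair_scale: "pair (sY r y) x = r * pair y x"
proof -
  have "module_hom sY (*) (\<lambda>y. pair y x)" using perfect by (simp add: perfect_pairing_def)
  then show ?thesis by (rule module_hom.scale)
qed

lemma pair_uminus: "pair (- y) x = - pair y x"
proof -
  have "module_hom sY (*) (\<lambda>y. pair y x)" using perfect by (simp add: perfect_pairing_def)
  then show ?thesis by (rule module_hom.neg)
qed

lemma T_linear: "Vector_Spaces.linear scale scale (T i)" and T_1: "T i 1 = 1"
  and T_mult: "T i (x * y) = T i x * T i y" and T_bij: "bij (T i)"
  using T_automorphism by (auto simp: alg_automorphism_def)

lemma star_linear: "Vector_Spaces.linear scale scale star" and star_1: "star 1 = 1"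
  and star_mult: "star (x * y) = star y * star x"
  using star_anti_involution by (auto simp: alg_anti_involution_def)

sublocale T: Vector_Spaces.linear scale scale "T i" for i by (rule T_linear)
sublocale star: Vector_Spaces.linear scale scale star by (rule star_linear)

lemmas T_hom = T.add T.diff T.neg T.scale T_mult T_1
lemmas star_hom = star.add star.diff star.neg star.scale star_mult star_1

section \<open>Strings of q-commutators and the braid operators\<close>

abbreviation "e0 \<equiv> e N0"
abbreviation "e1 \<equiv> e N1"
abbreviation "f1 \<equiv> f N1"
definition k1 where "k1 = K (h N1)"
definition k1i where "k1i = K (- h N1)"

lemma kk': "k1 * k1i = 1" "k1i * k1 = 1" by (simp_all add: k1_def k1i_def K_inverse)

lemma k1_e1: "k1 * e1 = scale q (e1 * k1)" and k1_e0: "k1 * e0 = scale (inverse q ^ 2) (e0 * k1)"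
  using K_e[of "h N1" N1] K_e[of "h N1" N0]
  by (simp_all add: k1_def pair_cartan q_def power_int_minus power_inverse flip: power_mult)

lemma k1i_e1: "k1i * e1 = scale (inverse q) (e1 * k1i)"
  using K_e[of "- h N1" N1]
  by (simp add: k1i_def pair_uminus pair_cartan q_def power_int_minus power_inverse flip: power_mult)

lemma e1_f1: "e1 * f1 = f1 * e1 + scale (inverse gq) (k1 - k1i)"
  using e_f[of N1 N1] by (simp add: k1_def k1i_def gq_def algebra_simps)

lemma e0_f1: "e0 * f1 = f1 * e0"
  using e_f[of N0 N1] by simp

text \<open>The string of iterated $q$-commutators with $e_1$ starting at $e_0$. Each exponent is the weight
  of the preceding member under conjugation by $k_1$, see \<open>k1_adE\<close>, which makes the commutator
  with $f_1$ collapse to a multiple of the preceding member.\<close>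

fun adE :: "nat \<Rightarrow> 'u" where
  "adE 0 = e0"
| "adE (Suc m) = e1 * adE m - scale (q powi (int m - 2)) (adE m * e1)"

fun f1_coeff :: "nat \<Rightarrow> Qq1" where
  "f1_coeff 0 = 0"
| "f1_coeff (Suc m) = f1_coeff m + (q powi (int m - 2) - q powi (2 - int m)) / gq"

lemma q_powi_Suc: "q powi (int (Suc m) - 2) = q * q powi (int m - 2)"
  by (simp add: power_int_add[symmetric, of q 1, simplified] algebra_simps)

lemma k1_adE: "k1 * adE m = scale (q powi (int m - 2)) (adE m * k1)"
proof (induction m)
  case 0
  show ?case by (simp add: k1_e0 power_int_minus power_inverse)
next
  case (Suc m)
  have 1: "k1 * (e1 * u) = scale q (e1 * (k1 * u))" for u
    by (simp add: mult.assoc[symmetric] k1_e1 scale_mult_left)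
  have 2: "k1 * (adE m * u) = scale (q powi (int m - 2)) (adE m * (k1 * u))" for u
    by (simp add: mult.assoc[symmetric] Suc scale_mult_left)
  show ?case unfolding q_powi_Suc by (simp add: algebra_simps alg_simps 1 2 k1_e1 Suc)
qed

lemma k1i_adE: "k1i * adE m = scale (q powi (2 - int m)) (adE m * k1i)"
proof -
  have "adE m = scale (q powi (int m - 2)) (k1i * adE m * k1)"
    using arg_cong[OF k1_adE[of m], of "\<lambda>u. k1i * u"] by (simp add: mult.assoc[symmetric] kk' alg_simps)
  then have "adE m * k1i = scale (q powi (int m - 2)) (k1i * adE m * k1) * k1i" by simp
  also have "\<dots> = scale (q powi (int m - 2)) (k1i * adE m)"
    by (simp add: mult.assoc kk' alg_simps)
  finally have "scale (q powi (2 - int m)) (adE m * k1i) = scale (q powi (2 - int m) * q powi (int m - 2)) (k1i * adE m)"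
    by simp
  also have "q powi (2 - int m) * q powi (int m - 2) = 1"
    by (simp add: power_int_add[symmetric])
  finally show ?thesis by simp
qed

text \<open>This is the lowering operator of the quantum $\mathfrak{sl}_2$ generated by $e_1$ and $f_1$, acting on
  the string. In the inductive step the bracket of $e_1$ with $f_1$ contributes the increment of
  the coefficient, while the old coefficient is carried along because the $q$-commutator of $e_1$
  with \<open>adE m * k1i\<close> is \<open>adE (Suc m) * k1i\<close>.\<close>

lemma adE_f1: "adE (Suc m) * f1 = f1 * adE (Suc m) + scale (f1_coeff (Suc m)) (adE m * k1i)"
proof -
  have base: "adE 0 * f1 = f1 * adE 0" by (simp add: e0_f1)
  have step: "adE (Suc m) * f1 - f1 * adE (Suc m) = e1 * c - scale (q powi (int m - 2)) (c * e1)
       + scale ((q powi (int m - 2) - q powi (2 - int m)) / gq) (adE m * k1i)"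
    if c: "adE m * f1 = f1 * adE m + c" for m c
  proof -
    have c': "adE m * (f1 * u) = f1 * (adE m * u) + c * u" for u
      by (simp only: mult.assoc[symmetric] c distrib_right)
    have d: "e1 * (f1 * u) = f1 * (e1 * u) + scale (inverse gq) (k1 * u - k1i * u)" for u
      by (simp only: mult.assoc[symmetric] e1_f1 distrib_right scale_mult_left left_diff_distrib)
    show ?thesis
      by (simp add: algebra_simps alg_simps c c' d e1_f1 k1_adE k1i_adE scale_left_diff_distrib diff_divide_distrib divide_inverse)
  qed
  show ?thesis
  proof (induction m)
    case 0
    show ?case using step[of 0 0] base by (simp add: algebra_simps)
  next
    case (Suc m)
    have "q powi (int (Suc m) - 2) * inverse q = q powi (int m - 2)"
      unfolding q_powi_Suc by simp
    then have "e1 * (adE m * k1i) - scale (q powi (int (Suc m) - 2)) (adE m * k1i * e1) = adE (Suc m) * k1i"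
      by (simp add: algebra_simps alg_simps k1i_e1)
    then have c: "e1 * scale (f1_coeff (Suc m)) (adE m * k1i) - scale (q powi (int (Suc m) - 2)) (scale (f1_coeff (Suc m)) (adE m * k1i) * e1)
      = scale (f1_coeff (Suc m)) (adE (Suc m) * k1i)"
      by (metis mult_scale_right scale_left_commute scale_mult_left scale_right_diff_distrib)
    show ?case
      using step[OF Suc, unfolded c]
      unfolding f1_coeff.simps(2)[of "Suc m"] scale_left_distrib diff_eq_eq by (simp only: add.commute)
  qed
qed

lemma adE_f1k: "adE (Suc m) * (f1 * k1) - scale (q powi (1 - int m)) (f1 * k1 * adE (Suc m)) = scale (f1_coeff (Suc m)) (adE m)"
proof -
  have "q powi (1 - int m) * q powi (int (Suc m) - 2) = 1"
    by (simp add: power_int_add[symmetric])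
  then have "scale (q powi (1 - int m)) (f1 * k1 * adE (Suc m)) = f1 * adE (Suc m) * k1"
    by (simp only: mult.assoc k1_adE mult_scale_right scale_scale scale_one)
  moreover have "adE (Suc m) * (f1 * k1) = f1 * adE (Suc m) * k1 + scale (f1_coeff (Suc m)) (adE m)"
    by (simp only: mult.assoc[symmetric] adE_f1 distrib_right scale_mult_left)
       (simp add: mult.assoc kk')
  ultimately show ?thesis by simp
qed

declare adE.simps [simp del] f1_coeff.simps [simp del]

lemma adE_unfold: "adE 1 = e1 * e0 - scale (inverse q ^ 2) (e0 * e1)"
  "adE 2 = e1 * adE 1 - scale (inverse q) (adE 1 * e1)"
  "adE 3 = e1 * adE 2 - adE 2 * e1"
  "adE 4 = e1 * adE 3 - scale q (adE 3 * e1)"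
  using adE.simps(2)[of 0] adE.simps(2)[of 1] adE.simps(2)[of 2] adE.simps(2)[of 3]
  by (simp_all add: adE.simps(1) One_nat_def[symmetric] Suc_1 power_int_minus power_inverse numeral_3_eq_3[symmetric])

lemma qint_values:
  "qint i 1 = 1" "qint N1 2 = q1 + inverse q1" "qint N1 3 = q + 1 + inverse q"
  "qint N1 4 = (q1 + inverse q1) * (q + inverse q)"
proof -
  have nz: "qn i - inverse (qn i) \<noteq> 0" for i
  proof (cases i)
    case N0
    then show ?thesis using q0_nz by simp
  next
    case N1
    then show ?thesis using gq_nz by (simp add: gq_def)
  qed
  show "qint i 1 = 1" using nz by (simp add: qint_def)
  have *: "qint N1 n = c" if "q1 ^ n - inverse q1 ^ n = c * (q1 - inverse q1)" for n c
    using nz[of N1] that by (simp add: qint_def)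
  have poly: "a ^ 2 - b ^ 2 = (a + b) * (a - b)" 
    "a ^ 4 - b ^ 4 = (a + b) * (a ^ 2 + b ^ 2) * (a - b)" for a b :: Qq1
    by algebra+
  have poly3: "a ^ 3 - b ^ 3 = (a ^ 2 + 1 + b ^ 2) * (a - b)" if "a * b = 1" for a b :: Qq1
    using that by algebra
  have q: "q = q1 ^ 2" "inverse q = inverse q1 ^ 2" by (simp_all add: q_def power_inverse)
  show "qint N1 2 = q1 + inverse q1" "qint N1 3 = q + 1 + inverse q"
    "qint N1 4 = (q1 + inverse q1) * (q + inverse q)"
    unfolding q(2) unfolding q(1) by (intro *, rule poly poly3, simp?)+
qed

lemma qint_nz: "qint N1 2 \<noteq> 0" "qint N1 3 \<noteq> 0" "qint N1 4 \<noteq> 0"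
proof -
  have "q1 * (q1 + inverse q1) = q + 1"
    by (simp add: q_def algebra_simps power2_eq_square)
  then have a: "q1 + inverse q1 \<noteq> 0" using q_plus_1 by auto
  have "q * (q + 1 + inverse q) = 1 + q + q^2"
    by (simp add: algebra_simps power2_eq_square)
  then have b: "q + 1 + inverse q \<noteq> 0" using q_cyc3 by auto
  have "q * (q + inverse q) = 1 + q^2"
    by (simp add: algebra_simps power2_eq_square)
  then have c: "q + inverse q \<noteq> 0" using q_cyc4 by auto
  show "qint N1 2 \<noteq> 0" "qint N1 3 \<noteq> 0" "qint N1 4 \<noteq> 0"
    unfolding qint_values using a b c by simp_all
qed

lemma f1_coeff_values: "f1_coeff 1 = - ((q ^ 2 - inverse q ^ 2) / gq)" "f1_coeff 2 = - (pq * bcoef 2 / gq)"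
  "f1_coeff 3 = - (qint N1 3 * qint N1 2)" "f1_coeff 4 = - qint N1 4"
proof -
  have a: "q1 * inverse q1 = 1" "q * inverse q = 1" by simp_all
  have g: "gq * f1_coeff 1 = inverse q ^ 2 - q ^ 2" "gq * f1_coeff 2 = gq * f1_coeff 1 + inverse q - q"
    "gq * f1_coeff 3 = gq * f1_coeff 2" "gq * f1_coeff 4 = gq * f1_coeff 3 + q - inverse q"
    using gq_nz f1_coeff.simps(2)[of 0] f1_coeff.simps(2)[of 1] f1_coeff.simps(2)[of 2] f1_coeff.simps(2)[of 3]
    by (simp_all add: f1_coeff.simps(1) One_nat_def[symmetric] Suc_1 power_int_minus power_inverse
        numeral_3_eq_3[symmetric] distrib_left)
  have *: "x = y" if "gq * x = gq * y" for x y using that gq_nz by simp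
  show "f1_coeff 1 = - ((q ^ 2 - inverse q ^ 2) / gq)" 
    by (rule *) (use g gq_nz in simp)
  show "f1_coeff 2 = - (pq * bcoef 2 / gq)"
  proof (rule *)
    have r: "gq * - (pq * bcoef 2 / gq) = - (pq * bcoef 2)" using gq_nz by simp
    show "gq * f1_coeff 2 = gq * - (pq * bcoef 2 / gq)"
      unfolding r unfolding g pq_def bcoef_2 by (simp add: algebra_simps power2_eq_square)
  qed
  have q2: "gq * qint N1 2 = q - inverse q"
    unfolding gq_def qint_values q_def by (simp add: algebra_simps power2_eq_square)
  show "f1_coeff 3 = - (qint N1 3 * qint N1 2)"
  proof (rule *)
    have r: "gq * - (qint N1 3 * qint N1 2) = - (qint N1 3 * (gq * qint N1 2))" by simp
    show "gq * f1_coeff 3 = gq * - (qint N1 3 * qint N1 2)"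
      unfolding r unfolding q2 unfolding qint_values g by (simp add: algebra_simps power2_eq_square)
  qed
  show "f1_coeff 4 = - qint N1 4"
  proof (rule *)
    have r: "gq * - qint N1 4 = - ((gq * qint N1 2) * (q + inverse q))" unfolding qint_values by simp
    show "gq * f1_coeff 4 = gq * - qint N1 4"
      unfolding r unfolding q2 g by (simp add: algebra_simps power2_eq_square)
  qed
qed

text \<open>The four operators $x \mapsto e_1x - c\,xe_1$ composed here are polynomials in the commuting left and
  right multiplications by $e_1$. The coefficients are therefore the elementary symmetric polynomials in
  the four scalars \<open>a\<close>, \<open>b\<close>, \<open>c\<close>, \<open>d\<close>.\<close>

lemma adE_4: "adE 4 = (\<Sum>r=0..4. scale ((-1)^r * (if r = 0 then 1 else if r = 1 then
   a + b + c + d else if r = 2 then a*b+a*c+a*d+b*c+b*d+c*d else if r = 3 then a*b*c+a*b*d+a*c*d+b*c*d else a*b*c*d)) 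
    (e1^(4-r) * e0 * e1^r))"
  if "a = inverse q ^ 2" "b = inverse q" "c = 1" "d = q"
proof -
  have "adE 2 = e1 * (e1 * e0) - scale (a + b) (e1 * (e0 * e1)) + scale (a * b) (e0 * (e1 * e1))"
    unfolding adE_unfold that
    by (simp add: algebra_simps alg_simps scale_left_distrib)
  note E2 = this
  have "adE 3 = e1 * (e1 * (e1 * e0)) - scale (a + b + c) (e1 * (e1 * (e0 * e1)))
     + scale (a * b + a * c + b * c) (e1 * (e0 * (e1 * e1))) - scale (a * b * c) (e0 * (e1 * (e1 * e1)))"
    unfolding adE_unfold(3) E2 \<open>c = 1\<close>
    by (simp add: algebra_simps alg_simps scale_left_distrib)
  note E3 = this
  have "adE 4 = e1 * (e1 * (e1 * (e1 * e0))) - scale (a + b + c + d) (e1 * (e1 * (e1 * (e0 * e1))))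
     + scale (a*b+a*c+a*d+b*c+b*d+c*d) (e1 * (e1 * (e0 * (e1 * e1))))
     - scale (a*b*c+a*b*d+a*c*d+b*c*d) (e1 * (e0 * (e1 * (e1 * e1)))) + scale (a*b*c*d) (e0 * (e1 * (e1 * (e1 * e1))))"
    unfolding adE_unfold(4) E3 \<open>d = q\<close>
    by (simp add: algebra_simps alg_simps scale_left_distrib)
  then show ?thesis
    by (simp add: eval_nat_numeral mult.assoc One_nat_def)
      (simp add: algebra_simps scale_left_distrib scale_left_diff_distrib)
qed

lemma qfact_Suc: "qfact i (Suc n) = qfact i n * qint i (Suc n)"
  by (simp add: qfact_def prod.nat_ivl_Suc')

lemma qfact_values: "qfact i 0 = 1" "qfact i 1 = 1" "qfact N1 2 = qint N1 2"
  "qfact N1 3 = qint N1 2 * qint N1 3" "qfact N1 4 = qint N1 2 * qint N1 3 * qint N1 4"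
proof -
  show 0: "qfact i 0 = 1" for i by (simp add: qfact_def)
  show 1: "qfact i 1 = 1" for i using qfact_Suc[of i 0] by (simp add: 0 qint_values(1) One_nat_def[symmetric])
  show 2: "qfact N1 2 = qint N1 2" using qfact_Suc[of N1 1] by (simp add: 1 Suc_1)
  show 3: "qfact N1 3 = qint N1 2 * qint N1 3" using qfact_Suc[of N1 2] by (simp add: 2)
  show "qfact N1 4 = qint N1 2 * qint N1 3 * qint N1 4" using qfact_Suc[of N1 3] by (simp add: 3)
qed

text \<open>The elementary symmetric polynomials in $q^{-2}, q^{-1}, 1, q$ are $q_1^{-r}$ times the
  $q_1$-binomial coefficients of 4 over $r$, which are also the coefficients in the divided-power formula for $T_1(e_0)$.\<close>

lemma T1_e0: "scale (qint N1 4 * qint N1 3 * qint N1 2) (T N1 e0) = adE 4"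
proof -
  let ?c = "qint N1 4 * qint N1 3 * qint N1 2"
  define w where "w r = e1^(4-r) * e0 * e1^r" for r
  define p where "p = inverse q1"
  have qs: "inverse q = p ^ 2" "q = q1 ^ 2" "q1 * p = 1"
    by (simp_all add: p_def q_def power_inverse)
  have "q1 powi (- int r) = p ^ r" for r by (simp add: p_def power_int_minus power_inverse)
  then have T: "T N1 e0 = (\<Sum>r=0..4. scale ((-1) ^ r * p ^ r)
         (divpow scale N1 e1 (4 - r) * e0 * divpow scale N1 e1 r))"
    using T_e[of N0 N1] by simp
  have "scale ?c (T N1 e0) = (\<Sum>r=0..4. scale (?c * ((-1) ^ r * p ^ r *
       (inverse (qfact N1 (4 - r)) * inverse (qfact N1 r)))) (w r))"
    unfolding T scale_sum_right divpow_def w_def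
    by (intro sum.cong refl) (simp only: scale_mult_left mult_scale_right scale_scale mult_ac)
  also have "\<dots> = adE 4"
    unfolding adE_4[OF refl refl refl refl] w_def[symmetric]
  proof (intro sum.cong refl arg_cong2[of _ _ _ _ scale])
    fix r :: nat assume "r \<in> {0..4}"
    then consider "r = 0" | "r = 1" | "r = 2" | "r = 3" | "r = 4" by fastforce
    then show "?c * ((-1) ^ r * p ^ r *
       (inverse (qfact N1 (4 - r)) * inverse (qfact N1 r))) =
      (-1)^r * (if r = 0 then 1 else if r = 1 then
   inverse q ^ 2 + inverse q + 1 + q else if r = 2 then inverse q ^ 2*inverse q+inverse q ^ 2*1+inverse q ^ 2*q+inverse q*1+inverse q*q+1*q else if r = 3 then inverse q ^ 2*inverse q*1+inverse q ^ 2*inverse q*q+inverse q ^ 2*1*q+inverse q*1*q else inverse q ^ 2*inverse q*1*q)"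
    proof cases
      case 1
      then show ?thesis using qint_nz by (simp add: qfact_values mult_ac)
    next
      case 2
      have "qint N1 4 * p = inverse q ^ 2 + inverse q + 1 + q"
        unfolding qint_values qs(1) unfolding qs(2) p_def[symmetric] using qs(3) by algebra
      moreover have "?c * ((-1) ^ r * p ^ r * (inverse (qfact N1 (4 - r)) * inverse (qfact N1 r))) = - (qint N1 4 * p)"
        using 2 qint_nz by (simp add: qfact_values qfact_values(2)[unfolded One_nat_def] field_simps)
      ultimately show ?thesis using 2 by simp
    next
      case 3
      have "qint N1 4 * qint N1 3 * p ^ 2 = qint N1 2 * (inverse q ^ 2*inverse q+inverse q ^ 2*1+inverse q ^ 2*q+inverse q*1+inverse q*q+1*q)"
        unfolding qint_values qs(1) unfolding qs(2) p_def[symmetric] using qs(3) by algebra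
      moreover have "qint N1 2 * (?c * ((-1) ^ r * p ^ r * (inverse (qfact N1 (4 - r)) * inverse (qfact N1 r)))) = qint N1 4 * qint N1 3 * p ^ 2"
        using 3 qint_nz by (simp add: qfact_values qfact_values(2)[unfolded One_nat_def] field_simps)
      ultimately have "qint N1 2 * (?c * ((-1) ^ r * p ^ r * (inverse (qfact N1 (4 - r)) * inverse (qfact N1 r))))
        = qint N1 2 * (inverse q ^ 2*inverse q+inverse q ^ 2*1+inverse q ^ 2*q+inverse q*1+inverse q*q+1*q)" by (rule trans[rotated])
      then show ?thesis using 3 qint_nz by simp
    next
      case 4
      have "qint N1 4 * p ^ 3 = inverse q ^ 2*inverse q*1+inverse q ^ 2*inverse q*q+inverse q ^ 2*1*q+inverse q*1*q"
        unfolding qint_values qs(1) unfolding qs(2) p_def[symmetric] using qs(3) by algebra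
      moreover have "?c * ((-1) ^ r * p ^ r * (inverse (qfact N1 (4 - r)) * inverse (qfact N1 r))) = - (qint N1 4 * p ^ 3)"
        using 4 qint_nz by (simp add: qfact_values qfact_values(2)[unfolded One_nat_def] field_simps)
      ultimately show ?thesis using 4 by simp
    next
      case 5
      have "p ^ 4 = inverse q ^ 2" by (simp add: p_def q_def power_inverse flip: power_mult)
      with 5 show ?thesis using qint_nz by (simp add: qfact_values qfact_values(2)[unfolded One_nat_def] field_simps)
    qed
  qed
  finally show ?thesis .
qed

lemma T1_e1: "T N1 e1 = - (f1 * k1)"
  using T_e_same[of N1] by (simp add: k1_def)

definition y1 where "y1 = e0 * e1 - scale (inverse q ^ 2) (e1 * e0)"
definition psi1 where "psi1 = bracket scale (inverse q) y1 e1"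

text \<open>The mirror images of the string members of weight $\alpha_0+\alpha_1$ and $\delta$ are
  $E_{\delta-\alpha_1}$ and $\tilde\psi_1$.\<close>

lemma star_adE: "star (adE 1) = y1" "star (adE 2) = psi1"
  by (simp_all add: adE_unfold y1_def psi1_def bracket_def star_hom star_e)

lemma star_k: "star k1 = k1i" "star k1i = k1" "star f1 = f1"
  by (simp_all add: k1_def k1i_def star_K star_f)

lemma star_y1: "star y1 = adE 1" "star psi1 = adE 2"
  unfolding star_adE[symmetric] using star_anti_involution by (simp_all add: alg_anti_involution_def)

text \<open>$T_1$ turns the bracketing with $e_1$ that builds $E_{\delta-\alpha_1}$ from $e_0$ into the lowering
  operator, so the string is traversed downwards from its top \<open>adE 4\<close>.\<close>

lemma T1_y1: "scale (qint N1 3 * qint N1 2) (T N1 y1) = adE 3"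
proof -
  let ?c = "qint N1 4 * qint N1 3 * qint N1 2"
  have "scale ?c (T N1 y1) = - (adE 4 * (f1 * k1) - scale (inverse q ^ 2) (f1 * k1 * adE 4))"
    unfolding y1_def T_hom T1_e1 T1_e0[symmetric] 
    by (simp add: alg_simps mult_ac)
  also have "\<dots> = - scale (f1_coeff 4) (adE 3)"
    using adE_f1k[of 3] by (simp add: power_int_minus power_inverse)
  finally have "scale (qint N1 4) (scale (qint N1 3 * qint N1 2) (T N1 y1)) = scale (qint N1 4) (adE 3)"
    by (simp add: f1_coeff_values mult.assoc)
  then show ?thesis using qint_nz by (simp only: scale_cancel_left) simp
qed

text \<open>One more lowering step brings $T_1(\tilde\psi_1)$ to the middle of the string. Together
  with \<open>T0_adE\<close> this is the $\tau$-invariance of $\tilde\psi_1$, and with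
  \<open>star_y1\<close> its invariance under $T_1^{-1}\ast$.\<close>

lemma T1_psi1: "T N1 psi1 = adE 2"
proof -
  let ?c = "qint N1 3 * qint N1 2"
  have "scale ?c (T N1 psi1) = - (adE 3 * (f1 * k1) - scale (inverse q) (f1 * k1 * adE 3))"
    unfolding psi1_def bracket_def T_hom T1_e1 T1_y1[symmetric]
    by (simp add: alg_simps mult_ac)
  also have "\<dots> = - scale (f1_coeff 3) (adE 2)"
    using adE_f1k[of 2] by (simp add: power_int_minus power_inverse)
  finally have "scale ?c (T N1 psi1) = scale ?c (adE 2)"
    by (simp add: f1_coeff_values)
  then show ?thesis using qint_nz by (simp only: scale_cancel_left) simp
qed

lemma T0_e1: "T N0 e1 = y1"
proof -
  have "T N0 e1 = (\<Sum>r=0..1. scale ((-1) ^ r * (q^2) powi (- int r))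
         (divpow scale N0 e0 (1 - r) * e1 * divpow scale N0 e0 r))"
    using T_e[of N1 N0] by (simp add: One_nat_def)
  also have "\<dots> = y1"
    by (simp add: y1_def divpow_def qfact_values power_int_minus power_inverse qfact_values(2)[unfolded One_nat_def] One_nat_def)
  finally show ?thesis .
qed

text \<open>The root $\alpha_0+\alpha_1$ is the reflection of $\alpha_1$ in $\alpha_0$, and \<open>adE 1\<close> is $T_0^{-1}(e_1)$: a
  computation in the quantum $\mathfrak{sl}_2$ of the index 0. The second equation follows since \<open>adE 2\<close> is
  a bracket of $e_1$ and \<open>adE 1\<close>.\<close>

lemma T0_adE: "T N0 (adE 1) = e1" "T N0 (adE 2) = psi1"
proof -
  define k0 k0i where "k0 = K (sY 4 (h N0))" and "k0i = K (- sY 4 (h N0))"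
  let ?f = "f N0"
  have kk: "k0i * k0 = 1" by (simp add: k0_def k0i_def K_inverse)
  have T0e0: "T N0 e0 = - (?f * k0)" using T_e_same[of N0] by (simp add: k0_def)
  have ke1: "k0 * e1 = scale (inverse q ^ 2) (e1 * k0)" and ke0: "k0 * e0 = scale (q ^ 4) (e0 * k0)"
    and kie1: "k0i * e1 = scale (q ^ 2) (e1 * k0i)"
    using K_e[of "sY 4 (h N0)" N1] K_e[of "sY 4 (h N0)" N0] K_e[of "- sY 4 (h N0)" N1]
    by (simp_all add: k0_def k0i_def pair_uminus pair_scale pair_cartan q_def power_int_minus power_inverse flip: power_mult)
  define r where "r = inverse (q^2 - inverse (q^2))"
  have ef: "e0 * ?f = ?f * e0 + scale r (k0 - k0i)" "e1 * ?f = ?f * e1"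
    using e_f[of N0 N0] e_f[of N1 N0] by (simp_all add: k0_def k0i_def r_def algebra_simps)
  have ef': "e0 * (?f * u) = ?f * (e0 * u) + scale r (k0 * u - k0i * u)" "e1 * (?f * u) = ?f * (e1 * u)" for u
    by (simp_all only: mult.assoc[symmetric] ef distrib_right scale_mult_left left_diff_distrib)
  have ke1': "k0 * (e1 * u) = scale (inverse q ^ 2) (e1 * (k0 * u))" and ke0': "k0 * (e0 * u) = scale (q ^ 4) (e0 * (k0 * u))" for u
    by (simp_all only: mult.assoc[symmetric] ke1 ke0 scale_mult_left)
  have sc: "q ^ 4 * inverse q ^ 2 = q ^ 2"
  proof -
    have "q ^ 4 * inverse q ^ 2 = q ^ 2 * (q ^ 2 * inverse q ^ 2)"
      by (simp only: mult.assoc[symmetric] flip: power_add) simp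
    also have "q ^ 2 * inverse q ^ 2 = 1" by (simp flip: power_mult_distrib)
    finally show ?thesis by simp
  qed
  have "k0 * (e0 * e1) = scale (q ^ 2) (e0 * e1 * k0)" "k0 * (e1 * e0) = scale (q ^ 2) (e1 * e0 * k0)"
    unfolding ke1' ke0' ke1 ke0 mult_scale_right scale_scale mult.assoc sc[symmetric]
    by (simp_all only: mult.commute)
  then have k0y: "k0 * y1 = scale (q^2) (y1 * k0)"
    unfolding y1_def by (simp only: right_diff_distrib left_diff_distrib scale_mult_left mult_scale_right
       scale_right_diff_distrib scale_scale mult.commute)
  have "scale (inverse q ^ 2) (?f * k0 * y1) = ?f * y1 * k0"
    by (simp only: mult.assoc k0y mult_scale_right scale_scale) (simp add: power_inverse)
  then have "T N0 (adE 1) = - ((y1 * ?f - ?f * y1) * k0)"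
    by (simp add: adE_unfold T_hom T0_e1 T0e0 power_inverse algebra_simps)
  also have "y1 * ?f - ?f * y1 = scale (r * (inverse q ^ 2 - q^2)) (e1 * k0i)"
  proof -
    have a: "e0 * e1 * ?f = ?f * (e0 * e1) + scale r (k0 * e1 - k0i * e1)"
      by (simp only: mult.assoc ef ef')
    have b: "e1 * e0 * ?f = ?f * (e1 * e0) + scale r (e1 * k0 - e1 * k0i)"
      by (simp only: mult.assoc ef ef' distrib_left mult_scale_right right_diff_distrib)
    have "y1 * ?f - ?f * y1 = scale r (k0 * e1 - k0i * e1) - scale (inverse q ^ 2) (scale r (e1 * k0 - e1 * k0i))"
      unfolding y1_def left_diff_distrib scale_mult_left a b
      by (simp add: right_diff_distrib scale_right_distrib mult_scale_right)
    also have "\<dots> = scale (r * inverse q ^ 2) (e1 * k0i) - scale (r * q ^ 2) (e1 * k0i)"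
      unfolding ke1 kie1 by (simp only: scale_right_diff_distrib scale_scale mult.commute) simp
    finally show ?thesis by (simp only: right_diff_distrib scale_left_diff_distrib)
  qed
  also have "r * (inverse q ^ 2 - q^2) = - 1"
  proof -
    have "r * (inverse q ^ 2 - q^2) = - (r * (q^2 - inverse (q^2)))"
      by (simp only: power_inverse minus_mult_right minus_diff_eq)
    also have "r * (q^2 - inverse (q^2)) = 1" unfolding r_def by (rule left_inverse[OF q0_nz])
    finally show ?thesis .
  qed
  finally show *: "T N0 (adE 1) = e1" by (simp add: mult.assoc kk)
  show "T N0 (adE 2) = psi1"
    by (simp only: adE_unfold(2) T_hom * T0_e1 psi1_def bracket_def)
qed

text \<open>After applying $T_1$ this is the lowering step from \<open>adE 2\<close> to \<open>adE 1\<close>.\<close>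

lemma psi1_e1: "psi1 * e1 = e1 * psi1 + scale (pq * bcoef 2 / gq) (inv (T N1) (adE 1))"
proof -
  have "T N1 (psi1 * e1 - e1 * psi1) = - (adE 2 * (f1 * k1) - f1 * k1 * adE 2)"
    by (simp add: T_hom T1_psi1 T1_e1)
  also have "\<dots> = - scale (f1_coeff 2) (adE 1)"
    using adE_f1k[of 1] by (simp add: numeral_2_eq_2 One_nat_def)
  also have "\<dots> = T N1 (scale (pq * bcoef 2 / gq) (inv (T N1) (adE 1)))"
    using T_bij[of N1] by (simp add: f1_coeff_values T_hom bij_is_surj surj_f_inv_f)
  finally have "psi1 * e1 - e1 * psi1 = scale (pq * bcoef 2 / gq) (inv (T N1) (adE 1))"
    using T_bij[of N1] by (simp add: bij_def inj_eq)
  then show ?thesis by (simp add: algebra_simps)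
qed

definition y0 where "y0 = - (k1i * f1)"

text \<open>Since $\ast$ sends $f_1k_1$ to $k_1^{-1}f_1 = -y_0$, applying it to \<open>adE_f1k\<close> yields the brackets
  with $y_0$ needed below.\<close>

lemma y0_star: "scale (q powi (1 - int m)) (star (adE (Suc m)) * y0) - y0 * star (adE (Suc m)) = scale (f1_coeff (Suc m)) (star (adE m))"
  using arg_cong[OF adE_f1k[of m], of star]
  by (simp add: star_hom star_k y0_def mult.assoc algebra_simps)

lemma y0_psi1: "y0 * psi1 = psi1 * y0 + scale (pq * bcoef 2 / gq) y1"
  using y0_star[of 1] unfolding numeral_2_eq_2[symmetric] One_nat_def[symmetric]
  by (simp add: star_adE f1_coeff_values algebra_simps)

lemma y1_y0: "y1 * y0 = scale (inverse q) (y0 * y1) - scale ((q - inverse q ^ 3) / gq) e0"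
proof -
  have "scale q (y1 * y0) - y0 * y1 = scale (f1_coeff 1) e0"
    using y0_star[of 0] unfolding One_nat_def[symmetric] star_adE by (simp add: star_e adE.simps(1))
  then have "scale (inverse q) (scale q (y1 * y0)) = scale (inverse q) (y0 * y1 + scale (f1_coeff 1) e0)"
    by (simp add: algebra_simps)
  also have "scale (inverse q) (y0 * y1 + scale (f1_coeff 1) e0) = scale (inverse q) (y0 * y1) + scale (inverse q * f1_coeff 1) e0"
    by (simp add: scale_right_distrib)
  also have "inverse q * f1_coeff 1 = - ((q - inverse q ^ 3) / gq)"
    by (simp add: f1_coeff_values divide_inverse algebra_simps power2_eq_square power3_eq_cube)
  finally show ?thesis by simp
qed

text \<open>This is the quantum Serre relation of degree 2 in $e_0$.\<close>

lemma e0_y1: "e0 * y1 = scale (q^2) (y1 * e0)"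
proof -
  define c where "c = qint N0 2"
  have "(q^2)^2 - inverse (q^2) ^ 2 = (q^2 + inverse (q^2)) * (q^2 - inverse (q^2))"
    by algebra
  then have c: "c = q^2 + inverse q ^ 2"
    using q0_nz by (simp add: c_def qint_def power_inverse)
  have qf: "qfact N0 2 = c"
    using qfact_Suc[of N0 1] unfolding Suc_1 qfact_values(2) c_def by simp
  have "{0..2} = {0, 1, 2::nat}" by auto
  have "serre scale e N0 N1 = 0" by (rule serre_e) simp
  then have "(\<Sum>k=0..2. (- 1) ^ k * divpow scale N0 e0 k * e1 * divpow scale N0 e0 (2 - k)) = 0"
    unfolding serre_def by simp
  then have "scale (inverse c) (e1 * (e0 * e0)) - e0 * e1 * e0 + scale (inverse c) (e0 * e0 * e1) = 0"
    unfolding \<open>{0..2} = {0, 1, 2}\<close>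
    by (simp add: divpow_def qfact_values qfact_values(2)[unfolded One_nat_def] qf alg_simps mult.assoc
        power2_eq_square add_diff_eq diff_add_eq)
  then have "e0 * e1 * e0 = scale (inverse c) (e1 * (e0 * e0) + e0 * e0 * e1)"
    by (simp add: scale_right_distrib algebra_simps)
  then have "scale c (e0 * e1 * e0) = scale (c * inverse c) (e1 * (e0 * e0) + e0 * e0 * e1)"
    by simp
  also have "c * inverse c = 1"
  proof -
    have "q^4 \<noteq> -1"
    proof
      assume "q ^ 4 = - 1"
      then have "to_fract (([:0, 1:] ^ 2) ^ 4 + 1) = (0 :: Qq1)" by (simp add: q_conv to_fract_power)
      then show False using to_fract_nonzero[of "([:0, 1:] ^ 2) ^ 4 + 1" 2] by simp
    qed
    moreover have "q^2 * c = q^4 + 1"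
    proof -
      have "q ^ 4 = q ^ 2 * q ^ 2" by (simp flip: power_add)
      moreover have "q ^ 2 * inverse q ^ 2 = 1" by (simp flip: power_mult_distrib)
      ultimately show ?thesis by (simp add: c distrib_left)
    qed
    ultimately have "c \<noteq> 0" by (auto simp: add_eq_0_iff2)
    then show ?thesis by simp
  qed
  finally have "e0 * (e0 * e1) = scale c (e0 * (e1 * e0)) - e1 * (e0 * e0)"
    by (simp add: algebra_simps)
  then show ?thesis
    unfolding y1_def c
    by (simp add: algebra_simps alg_simps scale_left_distrib) (simp flip: power_mult_distrib)
qed

lemma e0_psi1: "e0 * psi1 = psi1 * e0 + scale (bcoef 2) (y1 * y1)"
proof -
  have a: "e0 * e1 = y1 + scale (inverse q ^ 2) (e1 * e0)" by (simp add: y1_def)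
  have a': "e0 * (e1 * u) = y1 * u + scale (inverse q ^ 2) (e1 * (e0 * u))"
   and b': "e0 * (y1 * u) = scale (q^2) (y1 * (e0 * u))" for u
    by (simp_all only: mult.assoc[symmetric] a e0_y1 distrib_right scale_mult_left)
  show ?thesis unfolding psi1_def bracket_def
    by (simp add: algebra_simps alg_simps a a' b' e0_y1 bcoef_2 scale_left_diff_distrib power_inverse)
qed

section \<open>The root vectors\<close>

definition tau :: "'u \<Rightarrow> 'u" where "tau = Tw T"

definition Omega :: "'u \<Rightarrow> 'u" where "Omega = inv (T N1) \<circ> star"

text \<open>Integer powers of the bijection $\tau$. They are needed because the formal argument uses
  $x_n$ and $y_n$ for all integers $n$, while the root vectors are given by natural powers of
  $\tau^{-1}$ and $\tau$.\<close>

definition tpow :: "int \<Rightarrow> 'u \<Rightarrow> 'u" where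
  "tpow j = (if j \<ge> 0 then tau ^^ nat j else inv tau ^^ nat (- j))"

lemma tau_bij: "bij tau"
  by (simp add: tau_def Tw_def bij_comp T_bij)

lemma tau_automorphism: "alg_automorphism scale tau"
  using Vector_Spaces.linear_compose[OF T_linear[of N1] T_linear[of N0]] tau_bij
  by (simp add: alg_automorphism_def tau_def Tw_def T_hom)

lemma tau_tpow: "tau (tpow j x) = tpow (j + 1) x"
proof (cases "j \<ge> 0")
  case True
  then show ?thesis by (simp add: tpow_def nat_add_distrib One_nat_def)
next
  case False
  define m where "m = nat (- (j + 1))"
  have m: "nat (- j) = Suc m" using False by (simp add: m_def)
  have "tpow j x = inv tau ((inv tau ^^ m) x)"
    unfolding tpow_def m using False by simp
  moreover have "tpow (j + 1) x = (inv tau ^^ m) x"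
    using False by (cases "j = - 1") (simp_all add: tpow_def m_def)
  ultimately show ?thesis using tau_bij by (simp add: bij_is_surj surj_f_inv_f)
qed

definition xr :: "int \<Rightarrow> 'u" where "xr j = tpow (- j) e1"
definition yr :: "int \<Rightarrow> 'u" where "yr j = tpow j y0"

lemma T1_y0: "T N1 y0 = e1"
proof -
  have "sY (- 2) (h N1) = - h N1 - h N1"
  proof -
    have "module sY" using free_Y by (simp add: fg_free_def)
    then interpret Y: module sY .
    have "sY (- 1 + - 1) (h N1) = sY (- 1) (h N1) + sY (- 1) (h N1)"
      by (rule Y.scale_left_distrib)
    then show ?thesis by simp
  qed
  then have "T N1 k1i = k1"
    by (simp add: k1_def k1i_def T_K pair_uminus pair_cartan)
  moreover have "T N1 f1 = - (k1i * e1)" using T_f_same[of N1] by (simp add: k1i_def)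
  ultimately show ?thesis by (simp add: y0_def T_hom mult.assoc[symmetric] kk')
qed

lemma xr_yr_values: "xr 0 = e1" "yr 0 = y0" "yr 1 = y1" "T N1 (xr 1) = adE 1"
proof -
  show "xr 0 = e1" "yr 0 = y0" by (simp_all add: xr_def yr_def tpow_def)
  have "yr 1 = tau (tpow 0 y0)" unfolding yr_def tau_tpow by simp
  then show "yr 1 = y1" by (simp add: tpow_def tau_def Tw_def T1_y0 T0_e1)
  have "tau (xr 1) = e1" unfolding xr_def tau_tpow by (simp add: tpow_def)
  then have "T N0 (T N1 (xr 1)) = T N0 (adE 1)" by (simp add: tau_def Tw_def T0_adE)
  then show "T N1 (xr 1) = adE 1" using T_bij[of N0] by (simp add: bij_def inj_eq)
qed

lemma inv_T: "inv (T i) (T i x) = x" "T i (inv (T i) x) = x"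
  using T_bij[of i] by (simp_all add: bij_def inv_f_f surj_f_inv_f)

lemma xr_1: "xr 1 = inv (T N1) (adE 1)"
  unfolding xr_yr_values(4)[symmetric] inv_T ..

text \<open>Values of the inverse operators are found by exhibiting a preimage.\<close>

lemma inv_T_eqI: "T i y = x \<Longrightarrow> inv (T i) x = y"
  using inv_T by metis

lemma Omega_hom: "Omega (x + y) = Omega x + Omega y" "Omega (scale c x) = scale c (Omega x)"
  "Omega (x * y) = Omega y * Omega x" "Omega 1 = 1"
  unfolding Omega_def comp_apply
  by (rule inv_T_eqI, simp only: T_hom inv_T star_hom)+

lemma Omega_values: "Omega e1 = y0" "Omega y0 = e1" "Omega psi1 = psi1"
proof -
  have "T N1 e1 = star y0" by (simp add: T1_e1 y0_def star_hom star_k)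
  then show "Omega e1 = y0" "Omega y0 = e1" "Omega psi1 = psi1"
    by (simp_all add: Omega_def inv_T_eqI T1_y0 star_e T1_psi1 star_y1)
qed

lemma psi1_bracket: "bracket scale (inverse q) (yr 1) (xr 0) = psi1"
  by (simp add: xr_yr_values psi1_def)

sublocale loop: A22_loop scale xr yr e0 tau Omega
proof (intro A22_loop.intro A22_loop_axioms.intro)
  show "alg scale" by (rule alg_axioms)
  show "alg_automorphism scale tau" by (rule tau_automorphism)
  show "tau (xr j) = xr (j - 1)" "tau (yr j) = yr (j + 1)" for j
    by (simp_all add: xr_def yr_def tau_tpow)
  show "Vector_Spaces.linear scale scale Omega"
    by unfold_locales (simp_all add: Omega_hom)
  show "Omega 1 = 1" "Omega (x * y) = Omega y * Omega x" for x y by (simp_all add: Omega_hom)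
  show "Omega (xr 0) = yr 0" "Omega (yr 0) = xr 0" by (simp_all add: xr_yr_values Omega_values)
  let ?p = "bracket scale (inverse q) (yr 1) (xr 0)"
  show "tau ?p = ?p" by (simp add: psi1_bracket tau_def Tw_def T1_psi1 T0_adE)
  show "Omega ?p = ?p" by (simp add: psi1_bracket Omega_values)
  show "?p * xr 0 = xr 0 * ?p + scale (pq * bcoef 2 / gq) (xr 1)"
    unfolding psi1_bracket unfolding xr_yr_values(1) xr_1 by (rule psi1_e1)
  show "yr 0 * ?p = ?p * yr 0 + scale (pq * bcoef 2 / gq) (yr 1)"
    unfolding psi1_bracket unfolding xr_yr_values by (rule y0_psi1)
  show "yr 1 * yr 0 = scale (inverse q) (yr 0 * yr 1) - scale ((q - inverse q ^ 3) / gq) e0"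
    unfolding xr_yr_values by (rule y1_y0)
  show "e0 * xr 0 = scale ((inverse q)\<^sup>2) (xr 0 * e0) + yr 1"
    unfolding xr_yr_values by (simp add: y1_def)
  show "e0 * ?p = ?p * e0 + scale (bcoef 2) (yr 1 * yr 1)"
    unfolding psi1_bracket unfolding xr_yr_values by (rule e0_psi1)
qed

lemma Eplus_xr: "Eplus T e n = xr (int n)"
proof -
  have "inv tau = inv (T N1) \<circ> inv (T N0)"
    unfolding tau_def Tw_def by (rule o_inv_distrib) (simp_all add: T_bij)
  then show ?thesis by (cases "n = 0") (simp_all add: Eplus_def xr_def tpow_def)
qed

lemma Eminus_yr: assumes "n \<ge> 1" shows "Eminus T e n = yr (int n)"
proof -
  obtain m where m: "n = Suc m" using assms by (cases n) auto
  have "tau y0 = T N0 e1" by (simp add: tau_def Tw_def T1_y0)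
  then have "Eminus T e n = (tau ^^ m) (tau y0)"
    by (simp add: Eminus_def m tau_def Tw_def)
  also have "\<dots> = yr (int n)" by (simp add: yr_def tpow_def m funpow_swap1 del: of_nat_Suc)
  finally show ?thesis .
qed

lemma psi_Psi: "psi scale T e n = loop.Psi n"
  using Eminus_yr[of 1] by (cases "n = 0")
    (simp_all add: psi_def loop.Psi_def gq_def loop.W_def Eplus_xr of_nat_diff)

end

theorem proposition3p26:
  fixes sX :: "int \<Rightarrow> 'x \<Rightarrow> 'x::ab_group_add"
    and sY :: "int \<Rightarrow> 'y \<Rightarrow> 'y::ab_group_add"
    and pair :: "'y \<Rightarrow> 'x \<Rightarrow> int"
    and \<alpha> :: "node \<Rightarrow> 'x"
    and h :: "node \<Rightarrow> 'y"
    and scale :: "Qq1 \<Rightarrow> 'u \<Rightarrow> 'u::ring_1"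
    and K :: "'y \<Rightarrow> 'u"
    and e f :: "node \<Rightarrow> 'u"
    and T :: "node \<Rightarrow> 'u \<Rightarrow> 'u"
    and star :: "'u \<Rightarrow> 'u"
    and n :: nat
  assumes U: "quantum_A22 sX sY pair \<alpha> h scale K e f T star"
    and n: "n \<ge> 1"
  shows "(Tw T (psi scale T e n) = psi scale T e n) \<and>
    (\<forall>k\<ge>1. \<forall>l. k + l = n \<longrightarrow>
           bracket scale (inverse q) (Eminus T e k) (Eplus T e l) = psi scale T e n) \<and>
    ((inv (T N1) \<circ> star) (psi scale T e n) = psi scale T e n) \<and>
    (\<forall>k. bracket scale 1 (psi scale T e n) (Eplus T e k) =
           scale (1 + inverse q)
             (\<Sum>i=0..n-1. scale (bcoef (2 * (int n - int i)))
                (Eplus T e (k + n - i) * psi scale T e i))) \<and>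
    (\<forall>k\<ge>1. bracket scale 1 (Eminus T e k) (psi scale T e n) =
           scale (1 + inverse q)
             (\<Sum>i=0..n-1. scale (bcoef (2 * (int n - int i)))
                (psi scale T e i * Eminus T e (k + n - i)))) \<and>
    (bracket scale 1 (psi scale T e n) (psi scale T e 1) = 0) \<and>
    (bracket scale (inverse q ^ 2) (Ezero T e 0) (Eplus T e n) =
           scale (q1 - inverse q1)
             (\<Sum>i=0..n. scale (bcoef (2 * (int n - int i) + 1))
                (psi scale T e i * Eminus T e (n - i + 1))))"
proof -
  interpret quantum_A22 sX sY pair \<alpha> h scale K e f T star by (rule U)
  have inv: "tau (loop.Psi i) = loop.Psi i" and r5: "loop.Y_psi_rel i" if "i \<le> n" for i
    using loop.loop_relations[of n] that by auto
  have r4: "loop.psi_X_rel n" by (rule loop.psi_X_rel_from_Y_psi_rel[OF inv r5]) auto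
  have r7: "loop.z_X_rel n" and comm: "loop.Psi 1 * loop.Psi n = loop.Psi n * loop.Psi 1"
    using loop.loop_relations[of n] by auto
  have range: "{0..n-1} = {..<n}" "{0..n} = {..n}" using n by auto
  have br1: "bracket scale 1 x y = x * y - y * x" for x y by (simp add: bracket_def)
  have "Tw T (psi scale T e n) = psi scale T e n"
    using inv[of n] by (simp add: psi_Psi tau_def)
  moreover have "bracket scale (inverse q) (Eminus T e k) (Eplus T e l) = psi scale T e n"
    if "k \<ge> 1" "k + l = n" for k l
    using loop.W_Psi[OF n inv, of "int k"] that
    by (auto simp: Eminus_yr Eplus_xr psi_Psi loop.W_def)
  moreover have "(inv (T N1) \<circ> star) (psi scale T e n) = psi scale T e n"
    using loop.Omega_Psi[OF n inv] by (simp add: psi_Psi Omega_def)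
  moreover have "bracket scale 1 (psi scale T e n) (Eplus T e k) =
           scale (1 + inverse q)
             (\<Sum>i=0..n-1. scale (bcoef (2 * (int n - int i)))
                (Eplus T e (k + n - i) * psi scale T e i))" for k
  proof -
    have "bracket scale 1 (psi scale T e n) (Eplus T e k) =
       scale pq (\<Sum>i<n. scale (beven (n - i)) (xr (int k + int (n - i)) * loop.Psi i))"
      using r4 by (simp add: br1 psi_Psi Eplus_xr loop.psi_X_rel_def)
    also have "(\<Sum>i<n. scale (beven (n - i)) (xr (int k + int (n - i)) * loop.Psi i)) =
       (\<Sum>i<n. scale (bcoef (2 * (int n - int i))) (Eplus T e (k + n - i) * psi scale T e i))"
      by (intro sum.cong refl) (simp add: beven_def of_nat_diff Eplus_xr psi_Psi add_diff_eq)
    finally show ?thesis by (simp only: range pq_def)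
  qed
  moreover have "bracket scale 1 (Eminus T e k) (psi scale T e n) =
           scale (1 + inverse q)
             (\<Sum>i=0..n-1. scale (bcoef (2 * (int n - int i)))
                (psi scale T e i * Eminus T e (k + n - i)))" if "k \<ge> 1" for k
  proof -
    have "bracket scale 1 (Eminus T e k) (psi scale T e n) =
       scale pq (\<Sum>i<n. scale (beven (n - i)) (loop.Psi i * yr (int k + int (n - i))))"
      using r5[of n] that by (simp add: br1 psi_Psi Eminus_yr loop.Y_psi_rel_def)
    also have "(\<Sum>i<n. scale (beven (n - i)) (loop.Psi i * yr (int k + int (n - i)))) =
       (\<Sum>i<n. scale (bcoef (2 * (int n - int i))) (psi scale T e i * Eminus T e (k + n - i)))"
      using that
      by (intro sum.cong refl) (simp add: beven_def of_nat_diff Eminus_yr psi_Psi add_diff_eq)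
    finally show ?thesis by (simp only: range pq_def)
  qed
  moreover have "bracket scale 1 (psi scale T e n) (psi scale T e 1) = 0"
    using comm by (simp add: br1 psi_Psi)
  moreover have "bracket scale (inverse q ^ 2) (Ezero T e 0) (Eplus T e n) =
           scale (q1 - inverse q1)
             (\<Sum>i=0..n. scale (bcoef (2 * (int n - int i) + 1))
                (psi scale T e i * Eminus T e (n - i + 1)))"
  proof -
    have "bracket scale (inverse q ^ 2) (Ezero T e 0) (Eplus T e n)
      = scale gq (\<Sum>i\<le>n. scale (bodd (n - i)) (loop.Psi i * yr (int (n - i) + 1)))"
      using r7 by (simp add: bracket_def Ezero_def Eplus_xr loop.z_X_rel_def)
    also have "(\<Sum>i\<le>n. scale (bodd (n - i)) (loop.Psi i * yr (int (n - i) + 1)))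
      = (\<Sum>i\<le>n. scale (bcoef (2 * (int n - int i) + 1)) (psi scale T e i * Eminus T e (n - i + 1)))"
      by (intro sum.cong refl) (simp add: bodd_def of_nat_diff Eminus_yr psi_Psi algebra_simps)
    finally show ?thesis by (simp only: range gq_def)
  qed
  ultimately show ?thesis by blast
qed

end
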